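(* Let $G$ be a locally profinite group, $G^\natural$ a $G$-twisted space and $\omega$ a character of $G$. Assume that there exist $\delta_1\in G^\natural$ and a fundamental system of neighborhoods of $1$ in $G$ consisting of open compact subgroups $K$ with ${\rm Int}_{G^\natural}(\delta_1)(K)=K$. Let $\Pi_1,\Pi_2,\ldots,\Pi_n$ be admissible $\omega$-representations of $G^\natural$ which are $G$-irreducible (i.e. each $\Pi_i^\circ$ is an irreducible representation of $G$), such that the representations $\Pi_1^\circ,\Pi_2^\circ,\ldots,\Pi_n^\circ$ of $G$ are pairwise non-isomorphic. Then the distributions $\Theta_{\Pi_1},\Theta_{\Pi_2},\ldots,\Theta_{\Pi_n}$ on $G^\natural$ are linearly independent.
   Context: A $G$-twisted space is a topological space $G^\natural$ with a continuous left action of $G$ such that $g\mapsto g\cdot\delta$ is a homeomorphism $G\to G^\natural$ for each $\delta\in G^\natural$, together with a map ${\rm Int}_{G^\natural}:G^\natural\to{\rm Aut}(G)$ (automorphisms of topological group) with ${\rm Int}_{G^\natural}(g\cdot\delta)={\rm Int}_G(g)\circ{\rm Int}_{G^\natural}(\delta)$; the right action is $\delta\cdot g={\rm Int}_{G^\natural}(\delta)(g)\cdot\delta$. A character of $G$ is a continuous morphism $G\to\mathbb C^\times$. A smooth $\omega$-representation of $G^\natural$ is a smooth complex representation $(\pi,V)$ of $G$ with a map $\Pi:G^\natural\to{\rm Aut}_{\mathbb C}(V)$ such that $\Pi(x\cdot\gamma\cdot y)=\omega(y)\pi(x)\circ\Pi(\gamma)\circ\pi(y)$; $\pi=\Pi^\circ$;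 $\Pi$ is admissible if $\pi$ is. Fix a left Haar measure $d_lg$ on $G$ and let $d_l\delta$ be its image under $g\mapsto\delta_0\cdot g$ (independent of $\delta_0\in G^\natural$). For $\Pi$ admissible and $\phi\in C_{\rm c}^\infty(G^\natural)$ (locally constant compactly supported), $\Theta_\Pi(\phi)={\rm tr}\int_{G^\natural}\phi(\delta)\Pi(\delta)d_l\delta$. *)

theory Defs
  imports "HOL-Analysis.Analysis"
begin

text \<open>
  Topological groups are types of the library class \<open>topological_group_add\<close>. The group law is
  therefore written additively, but it is not assumed to be commutative.
\<close>

section \<open>Locally profinite groups\<close>

definition (in group_add) add_subgroup :: "'a set \<Rightarrow> bool" where
  "add_subgroup K \<longleftrightarrow> 0 \<in> K \<and> (\<forall>x\<in>K. \<forall>y\<in>K. x + y \<in> K) \<and> (\<forall>x\<in>K. - x \<in> K)"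

definition (in topological_group_add) open_compact_subgroup :: "'a set \<Rightarrow> bool" where
  "open_compact_subgroup K \<longleftrightarrow> add_subgroup K \<and> open K \<and> compact K"

class locally_profinite_group = topological_group_add + t2_space +
  assumes open_compact_subgroup_in_nbhd:
    "open U \<Longrightarrow> 0 \<in> U \<Longrightarrow> \<exists>K. open_compact_subgroup K \<and> K \<subseteq> U"

definition fundamental_nbhds_0 :: "'g::topological_group_add set set \<Rightarrow> bool" where
  "fundamental_nbhds_0 \<K> \<longleftrightarrow>
     (\<forall>K\<in>\<K>. 0 \<in> interior K) \<and> (\<forall>U. open U \<and> 0 \<in> U \<longrightarrow> (\<exists>K\<in>\<K>. K \<subseteq> U))"

definition top_group_automorphism :: "('g::topological_group_add \<Rightarrow> 'g) \<Rightarrow> bool" where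
  "top_group_automorphism f \<longleftrightarrow>
     (\<forall>x y. f (x + y) = f x + f y) \<and> (\<exists>f'. homeomorphism UNIV UNIV f f')"

text \<open>A continuous morphism to the multiplicative group of nonzero complex numbers.\<close>

definition group_character :: "('g::topological_group_add \<Rightarrow> complex) \<Rightarrow> bool" where
  "group_character \<omega> \<longleftrightarrow>
     continuous_on UNIV \<omega> \<and> (\<forall>g. \<omega> g \<noteq> 0) \<and> (\<forall>g h. \<omega> (g + h) = \<omega> g * \<omega> h)"

text \<open>A nonzero left-invariant Radon measure on the Borel sets.\<close>

definition left_haar_measure :: "'g::topological_group_add measure \<Rightarrow> bool" where
  "left_haar_measure \<mu> \<longleftrightarrow>
     sets \<mu> = sets borel \<and>
     emeasure \<mu> UNIV \<noteq> 0 \<and>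
     (\<forall>g. \<forall>A\<in>sets borel. emeasure \<mu> ((+) g ` A) = emeasure \<mu> A) \<and>
     (\<forall>K. compact K \<longrightarrow> emeasure \<mu> K < \<infinity>) \<and>
     (\<forall>A\<in>sets borel. emeasure \<mu> A = (INF U\<in>{U. open U \<and> A \<subseteq> U}. emeasure \<mu> U)) \<and>
     (\<forall>U. open U \<longrightarrow> emeasure \<mu> U = (SUP K\<in>{K. compact K \<and> K \<subseteq> U}. emeasure \<mu> K))"

section \<open>Twisted spaces\<close>

locale twisted_space =
  fixes act :: "'g::topological_group_add \<Rightarrow> 'x::topological_space \<Rightarrow> 'x"
    and IntX :: "'x \<Rightarrow> 'g \<Rightarrow> 'g"
  assumes act_zero: "act 0 \<delta> = \<delta>"
    and act_add: "act (g + h) \<delta> = act g (act h \<delta>)"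
    and act_continuous: "continuous_on UNIV (\<lambda>(g, \<delta>). act g \<delta>)"
    and orbit_homeomorphism: "\<exists>f'. homeomorphism UNIV UNIV (\<lambda>g. act g \<delta>) f'"
    and IntX_automorphism: "top_group_automorphism (IntX \<delta>)"
    and IntX_act: "IntX (act g \<delta>) = (\<lambda>x. g + x - g) \<circ> IntX \<delta>"

definition right_act :: "('g \<Rightarrow> 'x \<Rightarrow> 'x) \<Rightarrow> ('x \<Rightarrow> 'g \<Rightarrow> 'g) \<Rightarrow> 'x \<Rightarrow> 'g \<Rightarrow> 'x" where
  "right_act act IntX \<delta> g = act (IntX \<delta> g) \<delta>"

definition twisted_measure ::
    "('g \<Rightarrow> 'x \<Rightarrow> 'x::topological_space) \<Rightarrow> ('x \<Rightarrow> 'g \<Rightarrow> 'g) \<Rightarrow> 'g measure \<Rightarrow> 'x \<Rightarrow> 'x measure" where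
  "twisted_measure act IntX \<mu> \<delta>\<^sub>0 = distr \<mu> borel (right_act act IntX \<delta>\<^sub>0)"

definition locally_constant :: "('x::topological_space \<Rightarrow> 'a) \<Rightarrow> bool" where
  "locally_constant \<phi> \<longleftrightarrow> (\<forall>x. \<exists>U. open U \<and> x \<in> U \<and> \<phi> constant_on U)"

definition Cc_infty :: "('x::topological_space \<Rightarrow> complex) set" where
  "Cc_infty = {\<phi>. locally_constant \<phi> \<and> compact (closure {x. \<phi> x \<noteq> 0})}"

section \<open>Representations\<close>

text \<open>
  A representation space is a linear subspace \<open>V\<close> of an ambient complex vector space (a type with a
  scalar multiplication), so that finite families of representations on different spaces can be
  formed; any such family can be realised inside the direct sum of its members. The values of
  operators outside of \<open>V\<close> are irrelevant.
\<close>

definition linear_betw ::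
    "(complex \<Rightarrow> 'v::ab_group_add \<Rightarrow> 'v) \<Rightarrow> 'v set \<Rightarrow> 'v set \<Rightarrow> ('v \<Rightarrow> 'v) \<Rightarrow> bool" where
  "linear_betw smul V W f \<longleftrightarrow>
     f ` V \<subseteq> W \<and>
     (\<forall>x\<in>V. \<forall>y\<in>V. f (x + y) = f x + f y) \<and> (\<forall>c. \<forall>x\<in>V. f (smul c x) = smul c (f x))"

definition linear_iso_betw ::
    "(complex \<Rightarrow> 'v::ab_group_add \<Rightarrow> 'v) \<Rightarrow> 'v set \<Rightarrow> 'v set \<Rightarrow> ('v \<Rightarrow> 'v) \<Rightarrow> bool" where
  "linear_iso_betw smul V W f \<longleftrightarrow> linear_betw smul V W f \<and> bij_betw f V W"

locale smooth_rep = vector_space smul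
  for smul :: "complex \<Rightarrow> 'v::ab_group_add \<Rightarrow> 'v" +
  fixes V :: "'v set" and \<pi> :: "'g::topological_group_add \<Rightarrow> 'v \<Rightarrow> 'v"
  assumes subspace_V: "subspace V"
    and \<pi>_aut: "linear_iso_betw smul V V (\<pi> g)"
    and \<pi>_add: "v \<in> V \<Longrightarrow> \<pi> (g + h) v = \<pi> g (\<pi> h v)"
    and smooth: "v \<in> V \<Longrightarrow> open {g. \<pi> g v = v}"
begin

definition fixed_vectors :: "'g set \<Rightarrow> 'v set" where
  "fixed_vectors K = {v\<in>V. \<forall>k\<in>K. \<pi> k v = v}"

definition admissible :: bool where
  "admissible \<longleftrightarrow>
     (\<forall>K. open_compact_subgroup K \<longrightarrow> (\<exists>B. finite B \<and> fixed_vectors K = span B))"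

definition irreducible :: bool where
  "irreducible \<longleftrightarrow>
     V \<noteq> {0} \<and>
     (\<forall>W. subspace W \<and> W \<subseteq> V \<and> (\<forall>g. \<pi> g ` W \<subseteq> W) \<longrightarrow> W = {0} \<or> W = V)"

end

definition rep_isomorphic ::
    "(complex \<Rightarrow> 'v::ab_group_add \<Rightarrow> 'v) \<Rightarrow> 'v set \<Rightarrow> ('g \<Rightarrow> 'v \<Rightarrow> 'v) \<Rightarrow>
     'v set \<Rightarrow> ('g \<Rightarrow> 'v \<Rightarrow> 'v) \<Rightarrow> bool" where
  "rep_isomorphic smul V \<pi> W \<rho> \<longleftrightarrow>
     (\<exists>f. linear_iso_betw smul V W f \<and> (\<forall>g. \<forall>v\<in>V. f (\<pi> g v) = \<rho> g (f v)))"

text \<open>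
  An \<open>\<omega>\<close>-representation of the twisted space: the operators \<open>T \<delta>\<close> over the smooth
  representation \<open>\<pi>\<close> of the group.
\<close>

locale omega_rep =
  twisted_space act IntX + smooth_rep smul V \<pi>
  for act :: "'g::topological_group_add \<Rightarrow> 'x::topological_space \<Rightarrow> 'x"
    and IntX :: "'x \<Rightarrow> 'g \<Rightarrow> 'g"
    and \<omega> :: "'g \<Rightarrow> complex"
    and smul :: "complex \<Rightarrow> 'v::ab_group_add \<Rightarrow> 'v"
    and V :: "'v set" and \<pi> :: "'g \<Rightarrow> 'v \<Rightarrow> 'v" +
  fixes T :: "'x \<Rightarrow> 'v \<Rightarrow> 'v"
  assumes T_aut: "linear_iso_betw smul V V (T \<delta>)"
    and T_act: "v \<in> V \<Longrightarrow>
      T (act x (right_act act IntX \<delta> y)) v = smul (\<omega> y) (\<pi> x (T \<delta> (\<pi> y v)))"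

section \<open>Distribution characters\<close>

text \<open>
  The integral of a locally constant, compactly supported function \<open>F\<close> with values in a complex
  vector space without topology; such an \<open>F\<close> takes only finitely many values.
\<close>

definition lc_integral ::
    "(complex \<Rightarrow> 'v::ab_group_add \<Rightarrow> 'v) \<Rightarrow> 'x measure \<Rightarrow> ('x \<Rightarrow> 'v) \<Rightarrow> 'v" where
  "lc_integral smul \<nu> F =
     (\<Sum>w\<in>range F - {0}. smul (complex_of_real (measure \<nu> (F -` {w}))) w)"

text \<open>
  The trace of an operator \<open>A\<close> of finite rank on \<open>V\<close> is the trace of its restriction to the
  finite-dimensional space \<open>A ` V\<close>, computed in any basis \<open>B\<close> of that space.
\<close>

definition finite_rank_trace ::
    "(complex \<Rightarrow> 'v::ab_group_add \<Rightarrow> 'v) \<Rightarrow> 'v set \<Rightarrow> ('v \<Rightarrow> 'v) \<Rightarrow> complex" where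
  "finite_rank_trace smul V A =
     (let B = (SOME B. finite B \<and> \<not> module.dependent smul B \<and> module.span smul B = A ` V)
      in \<Sum>b\<in>B. module.representation smul B (A b) b)"

definition Theta ::
    "(complex \<Rightarrow> 'v::ab_group_add \<Rightarrow> 'v) \<Rightarrow> 'v set \<Rightarrow> 'x measure \<Rightarrow> ('x \<Rightarrow> 'v \<Rightarrow> 'v) \<Rightarrow>
     ('x \<Rightarrow> complex) \<Rightarrow> complex" where
  "Theta smul V \<nu> T \<phi> =
     finite_rank_trace smul V (\<lambda>v. lc_integral smul \<nu> (\<lambda>\<delta>. smul (\<phi> \<delta>) (T \<delta> v)))"

definition lin_indep_distributions ::
    "'i set \<Rightarrow> ('i \<Rightarrow> ('x::topological_space \<Rightarrow> complex) \<Rightarrow> complex) \<Rightarrow> bool" where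
  "lin_indep_distributions I D \<longleftrightarrow>
     (\<forall>c. (\<forall>\<phi>\<in>Cc_infty. (\<Sum>i\<in>I. c i * D i \<phi>) = 0) \<longrightarrow> (\<forall>i\<in>I. c i = 0))"

end

theory Submission
  imports Defs "HOL-Computational_Algebra.Fundamental_Theorem_Algebra"
begin

text \<open>
  The characters are separated by test functions. Fix one index \<open>i0\<close>. Let \<open>K\<close> be an open compact
  subgroup, stable under \<open>IntX \<delta>\<^sub>1\<close>, that fixes a nonzero vector \<open>w\<close> of the representation with index
  \<open>i0\<close>; it can be taken so small that \<open>\<omega>\<close> is trivial on it, by \<open>no_small_subgroups\<close>. Then every operator
  \<open>T i \<delta>\<^sub>1\<close> preserves the space of \<open>K\<close>-fixed vectors of the representation with index \<open>i\<close>.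

  To an element \<open>a = \<Sum> c [h]\<close> of the group algebra corresponds the test function \<open>\<phi>\<close> that is the sum of
  the multiples by \<open>c\<close> of the characteristic functions of \<open>h K \<cdot> \<delta>\<^sub>1\<close>. By \<open>lc_integral_test_function\<close>, the
  operator of \<open>\<phi>\<close> is, up to the volume of \<open>K \<cdot> \<delta>\<^sub>1\<close>, the composite of \<open>T i \<delta>\<^sub>1\<close>, the projection to the
  \<open>K\<close>-fixed vectors, and \<open>a\<close>. So only the action of \<open>a\<close> on the \<open>K\<close>-fixed vectors matters, and these
  form finite-dimensional spaces by admissibility.

  Since the representations are irreducible and pairwise non-isomorphic and satisfy Schur's lemma,
  \<open>density\<close> yields an \<open>a\<close> whose action on these finitely many finite-dimensional spaces is prescribed
  on bases: it is zero for the indices other than \<open>i0\<close>, and for \<open>i0\<close> it maps \<open>T i0 \<delta>\<^sub>1 w\<close> to \<open>w\<close> and kills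
  the rest of a basis. The resulting operator vanishes for the other indices, while for \<open>i0\<close> it has
  image spanned by \<open>w\<close> and eigenvalue the volume, which is nonzero. Evaluating a linear relation
  between the characters at \<open>\<phi>\<close> thus shows that the coefficient of index \<open>i0\<close> vanishes.
\<close>

section \<open>Integrals of simple functions\<close>

definition simple_integrable :: "'x measure \<Rightarrow> ('x \<Rightarrow> 'v::zero) \<Rightarrow> bool" where
  "simple_integrable \<nu> F \<longleftrightarrow>
     finite (range F) \<and> (\<forall>w. F -` {w} \<in> sets \<nu>) \<and> (\<forall>w. w \<noteq> 0 \<longrightarrow> emeasure \<nu> (F -` {w}) < \<infinity>)"

text \<open>
  The integral is defined by a sum over the values of the integrand, which makes additivity awkward.
  Here the sum runs over the level sets of any finer function \<open>H\<close> instead; taking for \<open>H\<close> the pair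
  of two integrands brings their integrals to a common index set.
\<close>

lemma lc_integral_coarsen:
  fixes H :: "'x \<Rightarrow> 'b" and w :: "'b \<Rightarrow> 'v::ab_group_add"
  assumes vs: "vector_space smul" and fin: "finite (range H)"
    and meas: "\<And>b. w b \<noteq> 0 \<Longrightarrow> H -` {b} \<in> sets \<nu> \<and> emeasure \<nu> (H -` {b}) < \<infinity>"
  shows "lc_integral smul \<nu> (\<lambda>x. w (H x)) =
    (\<Sum>b\<in>range H. smul (complex_of_real (measure \<nu> (H -` {b}))) (w b))"
proof -
  interpret vector_space smul by (rule vs)
  let ?m = "\<lambda>b. complex_of_real (measure \<nu> (H -` {b}))"
  let ?S = "{b \<in> range H. w b \<noteq> 0}"
  have finS: "finite ?S" using fin by simp
  have img: "w ` ?S = range (\<lambda>x. w (H x)) - {0}" by auto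
  have level: "(\<Sum>b | b \<in> ?S \<and> w b = y. smul (?m b) (w b)) =
      smul (complex_of_real (measure \<nu> ((\<lambda>x. w (H x)) -` {y}))) y"
    if "y \<in> range (\<lambda>x. w (H x)) - {0}" for y
  proof -
    let ?B = "{b. b \<in> ?S \<and> w b = y}"
    have un: "(\<lambda>x. w (H x)) -` {y} = (\<Union>b\<in>?B. H -` {b})" using that by auto
    have "measure \<nu> (\<Union>b\<in>?B. H -` {b}) = (\<Sum>b\<in>?B. measure \<nu> (H -` {b}))"
    proof (rule measure_finite_Union)
      show "finite ?B" using finS by (rule rev_finite_subset) auto
      show "(\<lambda>b. H -` {b}) ` ?B \<subseteq> sets \<nu>" using meas by auto
      show "disjoint_family_on (\<lambda>b. H -` {b}) ?B" by (auto simp: disjoint_family_on_def)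
      show "emeasure \<nu> (H -` {b}) \<noteq> \<infinity>" if "b \<in> ?B" for b
        using meas[of b] that by auto
    qed
    moreover have "(\<Sum>b\<in>?B. smul (?m b) (w b)) = (\<Sum>b\<in>?B. smul (?m b) y)"
      by (rule sum.cong) auto
    ultimately show ?thesis by (simp add: un scale_sum_left)
  qed
  have "(\<Sum>b\<in>range H. smul (?m b) (w b)) = (\<Sum>b\<in>?S. smul (?m b) (w b))"
    by (rule sum.mono_neutral_right) (use fin in auto)
  also have "\<dots> = (\<Sum>y\<in>w ` ?S. \<Sum>b | b \<in> ?S \<and> w b = y. smul (?m b) (w b))"
    by (rule sum.image_gen[OF finS])
  also have "\<dots> = lc_integral smul \<nu> (\<lambda>x. w (H x))"
    unfolding lc_integral_def img by (rule sum.cong) (use level in auto)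
  finally show ?thesis by simp
qed

lemma
  fixes F G :: "'x \<Rightarrow> 'v::ab_group_add"
  assumes vs: "vector_space smul" and F: "simple_integrable \<nu> F" and G: "simple_integrable \<nu> G"
  shows simple_integrable_add: "simple_integrable \<nu> (\<lambda>x. F x + G x)"
    and lc_integral_add:
      "lc_integral smul \<nu> (\<lambda>x. F x + G x) = lc_integral smul \<nu> F + lc_integral smul \<nu> G"
proof -
  interpret vector_space smul by (rule vs)
  define H where "H x = (F x, G x)" for x
  have fin: "finite (range H)"
    by (rule finite_subset[of _ "range F \<times> range G"])
      (use F G in \<open>auto simp: H_def simple_integrable_def\<close>)
  have vim: "H -` {b} = F -` {fst b} \<inter> G -` {snd b}" for b by (cases b) (auto simp: H_def)
  have sets: "H -` {b} \<in> sets \<nu>" for b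
    unfolding vim using F G by (auto simp: simple_integrable_def)
  have meas: "H -` {b} \<in> sets \<nu> \<and> emeasure \<nu> (H -` {b}) < \<infinity>"
    if "fst b \<noteq> 0 \<or> snd b \<noteq> 0" for b
  proof -
    have "emeasure \<nu> (H -` {b}) \<le> emeasure \<nu> (F -` {fst b})"
      "emeasure \<nu> (H -` {b}) \<le> emeasure \<nu> (G -` {snd b})"
      unfolding vim using F G by (auto simp: simple_integrable_def intro!: emeasure_mono)
    with that F G sets show ?thesis
      by (auto simp: simple_integrable_def intro: le_less_trans)
  qed
  show "simple_integrable \<nu> (\<lambda>x. F x + G x)"
    unfolding simple_integrable_def
  proof (intro conjI allI impI)
    have "range (\<lambda>x. F x + G x) = (\<lambda>b. fst b + snd b) ` range H" by (auto simp: H_def image_image)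
    with fin show "finite (range (\<lambda>x. F x + G x))" by simp
    have un: "(\<lambda>x. F x + G x) -` {w} = (\<Union>b\<in>{b\<in>range H. fst b + snd b = w}. H -` {b})" for w
      by (auto simp: H_def)
    show "(\<lambda>x. F x + G x) -` {w} \<in> sets \<nu>" for w
      unfolding un by (rule sets.finite_UN) (use fin sets in auto)
    show "emeasure \<nu> ((\<lambda>x. F x + G x) -` {w}) < \<infinity>" if "w \<noteq> 0" for w
    proof -
      have "emeasure \<nu> (\<Union>b\<in>{b\<in>range H. fst b + snd b = w}. H -` {b})
        \<le> (\<Sum>b\<in>{b\<in>range H. fst b + snd b = w}. emeasure \<nu> (H -` {b}))"
        by (rule emeasure_subadditive_finite) (use fin sets in auto)
      also have "\<dots> < \<infinity>"
      proof -
        have "emeasure \<nu> (H -` {b}) < top" if "b \<in> range H" "fst b + snd b = w" for b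
          using meas[of b] that \<open>w \<noteq> 0\<close> by force
        then show ?thesis using fin by auto
      qed
      finally show ?thesis unfolding un .
    qed
  qed
  have 1: "lc_integral smul \<nu> (\<lambda>x. fst (H x) + snd (H x)) =
      (\<Sum>b\<in>range H. smul (complex_of_real (measure \<nu> (H -` {b}))) (fst b + snd b))"
    by (rule lc_integral_coarsen[OF vs fin]) (rule meas, auto)
  have 2: "lc_integral smul \<nu> (\<lambda>x. fst (H x)) =
      (\<Sum>b\<in>range H. smul (complex_of_real (measure \<nu> (H -` {b}))) (fst b))"
    by (rule lc_integral_coarsen[OF vs fin]) (rule meas, auto)
  have 3: "lc_integral smul \<nu> (\<lambda>x. snd (H x)) =
      (\<Sum>b\<in>range H. smul (complex_of_real (measure \<nu> (H -` {b}))) (snd b))"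
    by (rule lc_integral_coarsen[OF vs fin]) (rule meas, auto)
  show "lc_integral smul \<nu> (\<lambda>x. F x + G x) = lc_integral smul \<nu> F + lc_integral smul \<nu> G"
    using 1 2 3 by (simp add: H_def scale_right_distrib sum.distrib)
qed

lemma
  fixes F :: "'x \<Rightarrow> 'v::ab_group_add"
  assumes vs: "vector_space smul" and F: "simple_integrable \<nu> F"
  shows simple_integrable_scale: "simple_integrable \<nu> (\<lambda>x. smul c (F x))"
    and lc_integral_scale: "lc_integral smul \<nu> (\<lambda>x. smul c (F x)) = smul c (lc_integral smul \<nu> F)"
proof -
  interpret vector_space smul by (rule vs)
  have F': "finite (range F)" "F -` {w} \<in> sets \<nu>" "w \<noteq> 0 \<Longrightarrow> emeasure \<nu> (F -` {w}) < \<infinity>" for w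
    using F by (auto simp: simple_integrable_def)
  have "UNIV = (\<Union>w\<in>range F. F -` {w})" by auto
  moreover have "\<dots> \<in> sets \<nu>" by (rule sets.finite_UN) (use F' in auto)
  ultimately have U: "UNIV \<in> sets \<nu>" by simp
  show "simple_integrable \<nu> (\<lambda>x. smul c (F x))"
  proof (cases "c = 0")
    case True
    then show ?thesis using U by (simp add: simple_integrable_def vimage_def)
  next
    case False
    have "(\<lambda>x. smul c (F x)) -` {w} = F -` {smul (inverse c) w}" for w
      using False by auto
    moreover have "range (\<lambda>x. smul c (F x)) = smul c ` range F" by auto
    ultimately show ?thesis using F' False by (simp add: simple_integrable_def)
  qed
  have "lc_integral smul \<nu> (\<lambda>x. smul c (F x)) =
      (\<Sum>b\<in>range F. smul (complex_of_real (measure \<nu> (F -` {b}))) (smul c b))"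
    by (rule lc_integral_coarsen[OF vs F'(1)]) (use F' in auto)
  moreover have "lc_integral smul \<nu> (\<lambda>x. F x) =
      (\<Sum>b\<in>range F. smul (complex_of_real (measure \<nu> (F -` {b}))) b)"
    by (rule lc_integral_coarsen[OF vs F'(1)]) (use F' in auto)
  ultimately show "lc_integral smul \<nu> (\<lambda>x. smul c (F x)) = smul c (lc_integral smul \<nu> F)"
    by (simp add: scale_sum_right mult.commute)
qed

section \<open>Traces of operators of rank at most one\<close>

lemma finite_rank_trace_zero:
  assumes vs: "vector_space smul" and "A ` V = {0}"
  shows "finite_rank_trace smul V A = 0"
proof -
  interpret vector_space smul by (rule vs)
  let ?P = "\<lambda>B. finite B \<and> independent B \<and> span B = A ` V"
  have "?P {}" using assms(2) independent_empty by auto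
  then have "?P (SOME B. ?P B)" by (rule someI)
  moreover have "B = {}" if "?P B" for B
    using that assms(2) dependent_zero[of B] span_superset[of B] by auto
  ultimately have "(SOME B. ?P B) = {}" by blast
  then show ?thesis by (simp add: finite_rank_trace_def)
qed

text \<open>
  Whatever basis the definition of the trace chooses, it consists of a single eigenvector.
\<close>

lemma finite_rank_trace_line:
  assumes vs: "vector_space smul" and "w \<noteq> 0" and img: "A ` V = module.span smul {w}"
    and A: "\<And>v. v \<in> module.span smul {w} \<Longrightarrow> A v = smul c v"
  shows "finite_rank_trace smul V A = c"
proof -
  interpret vector_space smul by (rule vs)
  let ?P = "\<lambda>B. finite B \<and> independent B \<and> span B = A ` V"
  define B where "B = (SOME B. ?P B)"
  have "?P {w}" using img \<open>w \<noteq> 0\<close> by simp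
  then have B: "?P B" unfolding B_def by (rule someI)
  have "independent {w}" using \<open>w \<noteq> 0\<close> by simp
  then have card: "card B = 1"
    using B img dim_eq_card_independent[of B] dim_eq_card_independent[of "{w}"] dim_span[of B]
      dim_span[of "{w}"] by simp
  have "representation B (A b) b = c" if "b \<in> B" for b
  proof -
    have b: "b \<in> span B" using that span_superset by blast
    then have "A b = smul c b" using A B img by simp
    then show ?thesis using b B that by (simp add: representation_scale representation_basis)
  qed
  then have "(\<Sum>b\<in>B. representation B (A b) b) = c" using card by simp
  then show ?thesis by (simp add: finite_rank_trace_def Let_def B_def)
qed

section \<open>Schur's lemma for admissible representations\<close>

lemma (in vector_space) finite_basis_of_finite_span:
  assumes "finite B" "S \<subseteq> W" "independent S" "W \<subseteq> span B"
  obtains C where "S \<subseteq> C" "C \<subseteq> W" "finite C" "independent C" "W \<subseteq> span C"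
proof -
  obtain C where C: "S \<subseteq> C" "C \<subseteq> W" "independent C" "W \<subseteq> span C"
    using maximal_independent_subset_extend[OF assms(2,3)] .
  have "finite C" using independent_span_bound[OF assms(1) C(3)] C(2) assms(4) by auto
  then show thesis using that C by blast
qed

lemma linear_betw_sum:
  assumes "module.subspace smul V" "vector_space smul" "linear_betw smul V V f"
    "\<And>x. x \<in> S \<Longrightarrow> g x \<in> V"
  shows "f (\<Sum>x\<in>S. g x) = (\<Sum>x\<in>S. f (g x))"
proof -
  interpret vector_space smul by fact
  have add: "f (x + y) = f x + f y" if "x \<in> V" "y \<in> V" for x y
    using assms(3) that by (auto simp: linear_betw_def)
  have "0 \<in> V" using assms(1) by (rule subspace_0)
  then have "f (smul 0 0) = smul 0 (f 0)"
    using assms(3) unfolding linear_betw_def by blast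
  then have zero: "f 0 = 0" by simp
  show ?thesis using assms(4)
  proof (induction S rule: infinite_finite_induct)
    case (insert x S)
    have "(\<Sum>x\<in>S. g x) \<in> V" using assms(1) insert by (intro subspace_sum) auto
    with insert show ?case by (simp add: add)
  qed (simp_all add: zero)
qed


text \<open>
  A nonzero polynomial \<open>p\<close> of least degree with \<open>p(f) v = 0\<close> exists because the iterates of \<open>v\<close> stay in
  a finite-dimensional space. If \<open>z\<close> is a root and \<open>p = (X - z) q\<close>, then \<open>q(f) v\<close> is an eigenvector,
  nonzero by minimality.
\<close>

lemma eigenvector_exists:
  fixes smul :: "complex \<Rightarrow> 'v::ab_group_add \<Rightarrow> 'v"
  assumes vs: "vector_space smul" and W: "module.subspace smul W"
    and fin: "finite B" "W \<subseteq> module.span smul B"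
    and f: "linear_betw smul W W f" and v: "v \<in> W" "v \<noteq> 0"
  shows "\<exists>u c. u \<in> W \<and> u \<noteq> 0 \<and> f u = smul c u"
proof -
  interpret vector_space smul by (rule vs)
  define it where "it k = (f ^^ k) v" for k
  have itW: "it k \<in> W" for k
    unfolding it_def using f v by (induction k) (auto simp: linear_betw_def)
  have itS: "f (it k) = it (Suc k)" for k by (simp add: it_def)
  (* ev p is p(f) v *)
  define ev where "ev p = (\<Sum>k\<le>degree p. smul (coeff p k) (it k))" for p
  have ev: "ev p = (\<Sum>k\<le>m. smul (coeff p k) (it k))" if "degree p \<le> m" for p m
    unfolding ev_def using that
    by (intro sum.mono_neutral_left) (auto simp: coeff_eq_0)
  have evW: "ev p \<in> W" for p
    unfolding ev_def using W itW by (intro subspace_sum subspace_scale) auto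
  have ev_pCons: "ev (pCons a p) = smul a v + f (ev p)" for a p
  proof -
    have "ev (pCons a p) = (\<Sum>k\<le>Suc (degree p). smul (coeff (pCons a p) k) (it k))"
      by (rule ev) (rule degree_pCons_le)
    also have "\<dots> = smul a v + (\<Sum>k\<le>degree p. smul (coeff p k) (it (Suc k)))"
      by (subst sum.atMost_Suc_shift) (simp add: it_def)
    also have "(\<Sum>k\<le>degree p. smul (coeff p k) (it (Suc k))) = f (ev p)"
      unfolding ev_def itS[symmetric]
      using linear_betw_sum[OF W vs f, of "{..degree p}" "\<lambda>k. smul (coeff p k) (it k)"]
        f itW W by (auto simp: linear_betw_def subspace_scale)
    finally show ?thesis .
  qed
  have ev_add: "ev (p + q) = ev p + ev q" for p q
    using ev[of p "max (degree p) (degree q)"] ev[of q "max (degree p) (degree q)"]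
      ev[of "p + q" "max (degree p) (degree q)"]
    by (simp add: degree_add_le_max scale_left_distrib sum.distrib)
  have ev_smult: "ev (smult a p) = smul a (ev p)" for a p
    using ev[of "smult a p" "degree p"] by (simp add: ev_def scale_sum_right degree_smult_le)
  have ev_0: "ev 0 = 0" by (simp add: ev_def)
  have "\<exists>p. p \<noteq> 0 \<and> ev p = 0"
  proof (cases "inj it")
    case False
    then obtain a b where ab: "a \<noteq> b" "it a = it b" by (auto simp: inj_def)
    have mon: "ev (monom 1 k) = it k" for k
    proof -
      have "ev (monom 1 k) = (\<Sum>j\<le>k. if j = k then it k else 0)"
        unfolding ev_def degree_monom_eq[OF one_neq_zero] by (rule sum.cong) auto
      then show ?thesis by simp
    qed
    have "ev (monom 1 a + smult (-1) (monom 1 b)) = 0"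
      unfolding ev_add ev_smult mon using ab by simp
    moreover have "coeff (monom 1 a + smult (-1) (monom 1 b)) a \<noteq> (0::complex)"
      using ab by simp
    then have "monom 1 a + smult (-1) (monom 1 b) \<noteq> (0::complex poly)" by (metis coeff_0)
    ultimately show ?thesis by blast
  next
    case True
    let ?S = "it ` {..card B}"
    have card: "card ?S = Suc (card B)" using True by (simp add: card_image inj_on_subset)
    have "dependent ?S"
    proof (rule ccontr)
      assume "independent ?S"
      from independent_span_bound[OF fin(1) this] have "card ?S \<le> card B"
        using itW fin(2) by blast
      with card show False by simp
    qed
    then obtain u where u: "\<exists>x\<in>?S. u x \<noteq> 0" "(\<Sum>x\<in>?S. smul (u x) x) = 0"
      by (subst (asm) dependent_finite) auto
    define p where "p = (\<Sum>k\<le>card B. monom (u (it k)) k)"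
    have cf: "coeff p k = (if k \<le> card B then u (it k) else 0)" for k
      by (simp add: p_def coeff_sum coeff_monom)
    have "degree p \<le> card B" by (rule degree_le) (simp add: cf)
    from ev[OF this] have "ev p = (\<Sum>k\<le>card B. smul (u (it k)) (it k))" by (simp add: cf)
    also have "\<dots> = (\<Sum>x\<in>?S. smul (u x) x)"
      using inj_on_subset[OF True] by (subst sum.reindex) auto
    finally have "ev p = 0" using u by simp
    moreover have "p \<noteq> 0" using u(1) cf by (metis atMost_iff coeff_0 imageE)
    ultimately show ?thesis by blast
  qed
  then obtain p where p: "p \<noteq> 0" "ev p = 0"
    and min: "\<And>q. q \<noteq> 0 \<Longrightarrow> ev q = 0 \<Longrightarrow> degree p \<le> degree q"
    using ex_has_least_nat[of "\<lambda>p. p \<noteq> 0 \<and> ev p = 0" _ degree] by blast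
  have "degree p \<noteq> 0"
  proof
    assume "degree p = 0"
    then obtain a where "p = [:a:]" using degree_eq_zeroE by blast
    with p v show False by (simp add: ev_def it_def)
  qed
  then obtain z where "poly p z = 0"
    using fundamental_theorem_of_algebra[of p] by (auto simp: constant_degree)
  then obtain q where q: "p = [:- z, 1:] * q" by (auto simp: poly_eq_0_iff_dvd)
  have "q \<noteq> 0" using p q by auto
  have "degree p = Suc (degree q)" 
    using q \<open>q \<noteq> 0\<close> degree_mult_eq[of "[:- z, 1:]" q] by (simp del: mult_pCons_left)
  then have "ev q \<noteq> 0" using min[of q] \<open>q \<noteq> 0\<close> by auto
  moreover have "p = smult (- z) q + pCons 0 q" using q by simp
  then have "ev p = smul (- z) (ev q) + f (ev q)"
    using ev_add[of "smult (- z) q" "pCons 0 q"] ev_smult[of "- z" q] ev_pCons[of 0 q] by simp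
  then have "f (ev q) = smul z (ev q)" using p by simp
  ultimately show ?thesis using evW by blast
qed

context smooth_rep
begin

lemma pi_closed: "v \<in> V \<Longrightarrow> \<pi> g v \<in> V"
  and pi_plus: "v \<in> V \<Longrightarrow> w \<in> V \<Longrightarrow> \<pi> g (v + w) = \<pi> g v + \<pi> g w"
  and pi_scale: "v \<in> V \<Longrightarrow> \<pi> g (smul c v) = smul c (\<pi> g v)"
  and pi_inj: "inj_on (\<pi> g) V"
  using \<pi>_aut[of g] by (auto simp: linear_iso_betw_def linear_betw_def bij_betw_def)

lemma pi_zero_vector: "\<pi> g 0 = 0"
  using pi_scale[of 0 g 0] subspace_0[OF subspace_V] by simp

lemma pi_zero: "v \<in> V \<Longrightarrow> \<pi> 0 v = v"
  using \<pi>_add[of v 0 0] pi_inj[of 0] pi_closed[of v 0] by (auto simp: inj_on_def)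

lemma pi_minus: "v \<in> V \<Longrightarrow> \<pi> (- g) (\<pi> g v) = v" "v \<in> V \<Longrightarrow> \<pi> g (\<pi> (- g) v) = v"
  using \<pi>_add[of v "- g" g] \<pi>_add[of v g "- g"] by (simp_all add: pi_zero)

lemma pi_sum: "(\<And>x. x \<in> S \<Longrightarrow> F x \<in> V) \<Longrightarrow> \<pi> g (\<Sum>x\<in>S. F x) = (\<Sum>x\<in>S. \<pi> g (F x))"
  using linear_betw_sum[OF subspace_V vector_space_axioms, of "\<pi> g" S F] \<pi>_aut[of g]
  by (simp add: linear_iso_betw_def)

lemma subspace_fixed_vectors: "subspace (fixed_vectors K)"
  using subspace_V unfolding subspace_def fixed_vectors_def
  by (auto simp: pi_plus pi_scale pi_zero_vector)

text \<open>
  An intertwining operator preserves the vectors fixed by \<open>K\<close>, a finite-dimensional space, and so has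
  an eigenvector there. The eigenspace is a nonzero subrepresentation, hence everything.
\<close>

lemma schur_scalar:
  assumes irr: irreducible and fin: "finite B" "fixed_vectors K \<subseteq> span B"
    and v: "v \<in> fixed_vectors K" "v \<noteq> 0"
    and f: "linear_betw smul V V f" "\<And>g v. v \<in> V \<Longrightarrow> f (\<pi> g v) = \<pi> g (f v)"
  shows "\<exists>c. \<forall>v\<in>V. f v = smul c v"
proof -
  have "linear_betw smul (fixed_vectors K) (fixed_vectors K) f"
    using f unfolding linear_betw_def fixed_vectors_def
    by (auto simp: image_subset_iff) (metis)
  from eigenvector_exists[OF vector_space_axioms subspace_fixed_vectors fin this v]
  obtain u c where u: "u \<in> V" "u \<noteq> 0" "f u = smul c u"
    by (auto simp: fixed_vectors_def)
  let ?W = "{v\<in>V. f v = smul c v}"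
  have f0: "f 0 = 0"
    using linear_betw_sum[OF subspace_V vector_space_axioms f(1), of "{}"] by simp
  have "subspace ?W"
    using subspace_V f(1) unfolding subspace_def linear_betw_def
    by (auto simp: scale_right_distrib f0 mult.commute)
  moreover have "\<pi> g ` ?W \<subseteq> ?W" for g using f(2) by (auto simp: pi_closed pi_scale)
  ultimately have "?W = {0} \<or> ?W = V" using irr unfolding irreducible_def by blast
  then show ?thesis using u by blast
qed

end

section \<open>Density for pairwise non-isomorphic irreducible representations\<close>

text \<open>
  A list of pairs stands for the element \<open>\<Sum> c [g]\<close> of the group algebra. Lists are convenient since
  addition is concatenation, and the same element can be applied to several representations at once.
\<close>

definition group_algebra_op ::
    "(complex \<Rightarrow> 'v::ab_group_add \<Rightarrow> 'v) \<Rightarrow> ('g \<Rightarrow> 'v \<Rightarrow> 'v) \<Rightarrow> (complex \<times> 'g) list \<Rightarrow> 'v \<Rightarrow> 'v" where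
  "group_algebra_op smul \<pi> a v = (\<Sum>(c, g)\<leftarrow>a. smul c (\<pi> g v))"

lemma group_algebra_op_Nil [simp]: "group_algebra_op smul \<pi> [] v = 0"
  and group_algebra_op_Cons [simp]: "group_algebra_op smul \<pi> ((c, g) # a) v =
    smul c (\<pi> g v) + group_algebra_op smul \<pi> a v"
  and group_algebra_op_append [simp]: "group_algebra_op smul \<pi> (a @ b) v =
    group_algebra_op smul \<pi> a v + group_algebra_op smul \<pi> b v"
  by (simp_all add: group_algebra_op_def)

definition scale_list :: "complex \<Rightarrow> (complex \<times> 'g) list \<Rightarrow> (complex \<times> 'g) list" where
  "scale_list c = map (\<lambda>(d, g). (c * d, g))"

definition translate_list :: "'g::plus \<Rightarrow> (complex \<times> 'g) list \<Rightarrow> (complex \<times> 'g) list" where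
  "translate_list h = map (\<lambda>(d, g). (d, h + g))"

lemma group_algebra_op_scale:
  assumes "vector_space smul"
  shows "group_algebra_op smul \<pi> (scale_list c a) v = smul c (group_algebra_op smul \<pi> a v)"
proof -
  interpret vector_space smul by fact
  show ?thesis by (induction a) (auto simp: scale_list_def scale_right_distrib)
qed

lemma group_algebra_op_sum:
  assumes "finite J"
  shows "\<exists>b. \<forall>i v. group_algebra_op smul (\<pi> i) b v =
    (\<Sum>j\<in>J. group_algebra_op smul (\<pi> i) (a j) v)"
  using assms
proof (induction J)
  case empty
  show ?case by (rule exI[of _ "[]"]) simp
next
  case (insert j J)
  then obtain b where "\<forall>i v. group_algebra_op smul (\<pi> i) b v =
    (\<Sum>j\<in>J. group_algebra_op smul (\<pi> i) (a j) v)" by blast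
  then show ?case using insert by (intro exI[of _ "a j @ b"]) simp
qed

context smooth_rep
begin

abbreviation "op \<equiv> group_algebra_op smul \<pi>"

lemma op_closed: "v \<in> V \<Longrightarrow> op a v \<in> V"
  by (induction a)
    (auto simp: subspace_0[OF subspace_V] pi_closed intro!: subspace_add subspace_scale subspace_V)

lemma op_translate: "v \<in> V \<Longrightarrow> op (translate_list h a) v = \<pi> h (op a v)"
proof (induction a)
  case (Cons x a)
  obtain c g where x: "x = (c, g)" by force
  show ?case using Cons
    by (simp add: x translate_list_def pi_plus pi_scale \<pi>_add op_closed pi_closed
        subspace_scale[OF subspace_V])
qed (simp add: translate_list_def pi_zero_vector)

lemma op_add: "v \<in> V \<Longrightarrow> w \<in> V \<Longrightarrow> op a (v + w) = op a v + op a w"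
  by (induction a) (auto simp: pi_plus scale_right_distrib algebra_simps)

lemma op_scale: "v \<in> V \<Longrightarrow> op a (smul c v) = smul c (op a v)"
  by (induction a) (auto simp: pi_scale scale_right_distrib mult.commute)

lemma irreducibleD:
  assumes irreducible "subspace W" "W \<subseteq> V" "\<And>g w. w \<in> W \<Longrightarrow> \<pi> g w \<in> W" "w \<in> W" "w \<noteq> 0"
  shows "W = V"
  using assms unfolding irreducible_def by blast

text \<open>
  The predicate \<open>P\<close> describes a left ideal of the group algebra; its orbit through \<open>v\<close> is a
  subrepresentation.
\<close>

lemma left_ideal_transitive:
  assumes irr: irreducible and v: "v \<in> V"
    and L: "\<And>a b. P a \<Longrightarrow> P b \<Longrightarrow> P (a @ b)" "\<And>c a. P a \<Longrightarrow> P (scale_list c a)"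
      "\<And>h a. P a \<Longrightarrow> P (translate_list h a)"
    and nz: "P a0" "op a0 v \<noteq> 0" and w: "w \<in> V"
  shows "\<exists>a. P a \<and> op a v = w"
proof -
  let ?W = "{op a v | a. P a}"
  have "?W = V"
  proof (rule irreducibleD[OF irr])
    show "subspace ?W" unfolding subspace_def
    proof (intro conjI ballI allI)
      have "0 = op (scale_list 0 a0) v"
        by (simp add: group_algebra_op_scale vector_space_axioms)
      then show "0 \<in> ?W" using nz L by blast
      show "x + y \<in> ?W" if xy: "x \<in> ?W" "y \<in> ?W" for x y
      proof -
        obtain a b where "P a" "P b" "x = op a v" "y = op b v" using xy by blast
        then have "x + y = op (a @ b) v" "P (a @ b)" using L by auto
        then show ?thesis by blast
      qed
      show "smul c x \<in> ?W" if x: "x \<in> ?W" for c x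
      proof -
        obtain a where "P a" "x = op a v" using x by blast
        then have "smul c x = op (scale_list c a) v" "P (scale_list c a)"
          using L by (auto simp: group_algebra_op_scale vector_space_axioms)
        then show ?thesis by blast
      qed
    qed
    show "?W \<subseteq> V" using v op_closed by blast
    show "\<pi> g w \<in> ?W" if gw: "w \<in> ?W" for g w
    proof -
      obtain a where "P a" "w = op a v" using gw by blast
      then have "\<pi> g w = op (translate_list g a) v" "P (translate_list g a)"
        using L v by (auto simp: op_translate)
      then show ?thesis by blast
    qed
    show "op a0 v \<in> ?W" using nz by blast
  qed (use nz in auto)
  with w show ?thesis by blast
qed

end

lemma irreducible_hom_zero_or_iso:
  assumes "smooth_rep smul V \<pi>" "smooth_rep.irreducible smul V \<pi>"
    and "smooth_rep smul W \<rho>" "smooth_rep.irreducible smul W \<rho>"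
    and f: "linear_betw smul V W f" "\<And>g v. v \<in> V \<Longrightarrow> f (\<pi> g v) = \<rho> g (f v)"
    and not_iso: "\<not> rep_isomorphic smul V \<pi> W \<rho>" and v: "v \<in> V"
  shows "f v = 0"
proof (rule ccontr)
  assume nz: "f v \<noteq> 0"
  interpret V: smooth_rep smul V \<pi> by fact
  interpret W: smooth_rep smul W \<rho> by fact
  have fV: "f x \<in> W" if "x \<in> V" for x using f(1) that by (auto simp: linear_betw_def)
  have add: "f (x + y) = f x + f y" if "x \<in> V" "y \<in> V" for x y
    using f(1) that by (auto simp: linear_betw_def)
  have scale: "f (smul c x) = smul c (f x)" if "x \<in> V" for c x
    using f(1) that by (auto simp: linear_betw_def)
  have V0: "0 \<in> V" using V.subspace_0[OF V.subspace_V] .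
  have f0: "f 0 = 0" using scale[OF V0, of 0] by simp
  have "f ` V = W"
  proof (rule W.irreducibleD)
    show "V.subspace (f ` V)" unfolding V.subspace_def
    proof (intro conjI ballI allI)
      show "0 \<in> f ` V" using f0 V0 by force
      show "x + y \<in> f ` V" if "x \<in> f ` V" "y \<in> f ` V" for x y
        using that add[symmetric] V.subspace_add[OF V.subspace_V] by auto
      show "smul c x \<in> f ` V" if "x \<in> f ` V" for c x
        using that scale[symmetric] V.subspace_scale[OF V.subspace_V] by auto
    qed
    show "\<rho> g w \<in> f ` V" if "w \<in> f ` V" for g w
      using that f(2)[symmetric] V.pi_closed by auto
  qed (use assms nz fV v in auto)
  moreover have "inj_on f V"
  proof (rule ccontr)
    assume "\<not> inj_on f V"
    then obtain x y where xy: "x \<in> V" "y \<in> V" "f x = f y" "x \<noteq> y" by (auto simp: inj_on_def)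
    let ?K = "{u \<in> V. f u = 0}"
    have xyV: "x - y \<in> V" using V.subspace_diff[OF V.subspace_V] xy by blast
    have "f (x - y) = 0" using add[OF xyV xy(2)] xy(3) by simp
    have "?K = V"
    proof (rule V.irreducibleD)
      show "V.subspace ?K" unfolding V.subspace_def
        using V.subspace_V V0 f0
        by (auto simp: add scale intro: V.subspace_add V.subspace_scale)
      show "\<pi> g w \<in> ?K" if "w \<in> ?K" for g w
        using that f(2) V.pi_closed W.pi_zero_vector by auto
      show "x - y \<in> ?K" using xyV \<open>f (x - y) = 0\<close> by simp
    qed (use assms xy in simp_all)
    with v nz show False by blast
  qed
  ultimately have "linear_iso_betw smul V W f"
    using f(1) by (simp add: linear_iso_betw_def bij_betw_def)
  with f(2) not_iso show False unfolding rep_isomorphic_def by blast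
qed

text \<open>
  This is the density theorem of Jacobson for the direct sum of pairwise non-isomorphic irreducible
  representations whose intertwining operators are scalars. By induction on the number of vectors,
  for each vector \<open>v\<close> other than \<open>v0\<close> the left ideal \<open>L\<close> of elements that kill all vectors besides \<open>v\<close> and
  \<open>v0\<close> acts transitively on \<open>v\<close>. If every element killing all the vectors besides \<open>v0\<close> killed \<open>v0\<close>
  too, then \<open>a v \<mapsto> a v0\<close> for \<open>a \<in> L\<close> would be a well-defined intertwining operator, so a scalar, which is zero
  when \<open>v\<close> lives in a different representation from \<open>v0\<close>. Decomposing the unit of the group algebra
  along these ideals then expresses \<open>v0\<close> as a combination of the other vectors of its
  representation, against linear independence.
\<close>

lemma density:
  fixes smul :: "complex \<Rightarrow> 'v::ab_group_add \<Rightarrow> 'v"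
    and V :: "'i \<Rightarrow> 'v set" and \<pi> :: "'i \<Rightarrow> 'g::topological_group_add \<Rightarrow> 'v \<Rightarrow> 'v"
  assumes vs: "vector_space smul"
    and rep: "\<And>i. i \<in> I \<Longrightarrow> smooth_rep smul (V i) (\<pi> i)"
    and irr: "\<And>i. i \<in> I \<Longrightarrow> smooth_rep.irreducible smul (V i) (\<pi> i)"
    and schur: "\<And>i f. i \<in> I \<Longrightarrow> linear_betw smul (V i) (V i) f \<Longrightarrow>
      (\<And>g v. v \<in> V i \<Longrightarrow> f (\<pi> i g v) = \<pi> i g (f v)) \<Longrightarrow> \<exists>c. \<forall>v\<in>V i. f v = smul c v"
    and not_iso: "\<And>i j. i \<in> I \<Longrightarrow> j \<in> I \<Longrightarrow> i \<noteq> j \<Longrightarrow>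
      \<not> rep_isomorphic smul (V i) (\<pi> i) (V j) (\<pi> j)"
    and fin: "finite J" and J: "\<And>i v. (i, v) \<in> J \<Longrightarrow> i \<in> I \<and> v \<in> V i"
    and ind: "\<And>i. \<not> module.dependent smul {v. (i, v) \<in> J}"
    and mem: "(i0, v0) \<in> J" and w: "w \<in> V i0"
  shows "\<exists>a. group_algebra_op smul (\<pi> i0) a v0 = w \<and>
    (\<forall>i v. (i, v) \<in> J - {(i0, v0)} \<longrightarrow> group_algebra_op smul (\<pi> i) a v = 0)"
  using fin J ind mem w
proof (induction "card J" arbitrary: J i0 v0 w rule: less_induct)
  case less
  interpret vector_space smul by (rule vs)
  let ?op = "\<lambda>i. group_algebra_op smul (\<pi> i)"
  let ?J = "J - {(i0, v0)}"
  define kills where "kills S a \<longleftrightarrow> (\<forall>i v. (i, v) \<in> S \<longrightarrow> ?op i a v = 0)" for S a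
  have kills_closed: "kills S a \<Longrightarrow> kills S b \<Longrightarrow> kills S (a @ b)"
    "kills S a \<Longrightarrow> kills S (scale_list c a)"
    "kills S a \<Longrightarrow> S \<subseteq> J \<Longrightarrow> kills S (translate_list h a)" for S a b c h
  proof -
    show "kills S (a @ b)" if "kills S a" "kills S b"
      using that by (fastforce simp: kills_def)
    show "kills S (scale_list c a)" if "kills S a"
      using that by (fastforce simp: kills_def group_algebra_op_scale[OF vs])
    show "kills S (translate_list h a)" if a: "kills S a" and "S \<subseteq> J"
      unfolding kills_def
    proof (intro allI impI)
      fix i v assume "(i, v) \<in> S"
      then have iv: "i \<in> I" "v \<in> V i" "?op i a v = 0"
        using that less.prems(2) by (auto simp: kills_def)
      interpret smooth_rep smul "V i" "\<pi> i" using rep iv by blast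
      show "?op i (translate_list h a) v = 0"
        using iv by (simp add: op_translate pi_zero_vector)
    qed
  qed
  have i0: "i0 \<in> I" "v0 \<in> V i0" using less.prems by auto
  interpret R0: smooth_rep smul "V i0" "\<pi> i0" using rep i0 by blast
  have "\<exists>a. kills ?J a \<and> ?op i0 a v0 \<noteq> 0"
  proof (rule ccontr)
    assume "\<not> ?thesis"
    then have kill: "?op i0 a v0 = 0" if "kills ?J a" for a using that by blast
    have IH: "\<exists>a. ?op i a v = w \<and> kills (?J - {(i, v)}) a" if "(i, v) \<in> ?J" "w \<in> V i" for i v w
      unfolding kills_def
    proof (rule less.hyps)
      show "card ?J < card J" using less.prems by (intro psubset_card_mono) auto
      show "independent {v. (i, v) \<in> ?J}" for i
        by (rule independent_mono[OF less.prems(3)[of i]]) auto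
    qed (use that less.prems in auto)
    have scalar: "\<exists>c. (i \<noteq> i0 \<longrightarrow> c = 0) \<and>
        (\<forall>a. kills (?J - {(i, v)}) a \<longrightarrow> ?op i0 a v0 = smul c (?op i a v))"
      if iv: "(i, v) \<in> ?J" for i v
    proof -
      have i: "i \<in> I" "v \<in> V i" using iv less.prems by auto
      interpret R: smooth_rep smul "V i" "\<pi> i" using rep i by blast
      let ?L = "kills (?J - {(i, v)})"
      define f where "f w = ?op i0 (SOME a. ?L a \<and> ?op i a v = w) v0" for w
      have f: "f (?op i a v) = ?op i0 a v0" if a: "?L a" for a
      proof -
        define b where "b = (SOME b. ?L b \<and> ?op i b v = ?op i a v)"
        have b: "?L b" "?op i b v = ?op i a v"
          using someI[of "\<lambda>b. ?L b \<and> ?op i b v = ?op i a v" a] a by (auto simp: b_def)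
        let ?d = "b @ scale_list (-1) a"
        have "?op i ?d v = 0" using b by (simp add: group_algebra_op_scale[OF vs])
        moreover have "?L ?d" using a b kills_closed by blast
        ultimately have "kills ?J ?d" unfolding kills_def by blast
        from kill[OF this] show ?thesis
          by (simp add: f_def b_def[symmetric] group_algebra_op_scale[OF vs])
      qed
      have L_closed: "?L (a @ b)" "?L (scale_list c a)" "?L (translate_list h a)"
        if "?L a" "?L b" for a b c h
      proof -
        show "?L (a @ b)" "?L (scale_list c a)" using that kills_closed(1,2) by blast+
        show "?L (translate_list h a)" by (rule kills_closed(3)[OF that(1)]) blast
      qed
      have lin: "linear_betw smul (V i) (V i0) f"
        unfolding linear_betw_def
      proof (intro conjI ballI allI image_subsetI)
        fix x assume x: "x \<in> V i"
        then obtain a where a: "?op i a v = x" "?L a" using IH iv by blast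
        show "f x \<in> V i0" using f[OF a(2)] a(1) R0.op_closed i0 by simp
        show "f (smul c x) = smul c (f x)" for c
          using f[OF a(2)] f[OF L_closed(2)[OF a(2) a(2)], of c] a(1)
          by (simp add: group_algebra_op_scale[OF vs])
        show "f (x + y) = f x + f y" if y: "y \<in> V i" for y
        proof -
          obtain b where b: "?op i b v = y" "?L b" using IH iv y by blast
          show ?thesis using f[OF a(2)] f[OF b(2)] f[OF L_closed(1)[OF a(2) b(2)]] a b by simp
        qed
      qed
      have equi: "f (\<pi> i g x) = \<pi> i0 g (f x)" if x: "x \<in> V i" for g x
      proof -
        obtain a where a: "?op i a v = x" "?L a" using IH iv x by blast
        show ?thesis using f[OF a(2)] f[OF L_closed(3)[OF a(2) a(2)], of g] a i i0
          by (simp add: R.op_translate R0.op_translate)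
      qed
      show ?thesis
      proof (cases "i = i0")
        case True
        obtain c where "\<forall>x\<in>V i0. f x = smul c x"
          using schur[OF i0(1), of f] lin equi True by blast
        then show ?thesis using f True i R.op_closed by (metis (no_types, lifting))
      next
        case False
        have "f x = 0" if "x \<in> V i" for x
          using irreducible_hom_zero_or_iso[OF rep irr rep irr lin equi not_iso that] i i0 False
          by blast
        then show ?thesis using f i R.op_closed by (intro exI[of _ 0]) (metis scale_zero_left)
      qed
    qed
    have "\<forall>j\<in>?J. \<exists>c. (fst j \<noteq> i0 \<longrightarrow> c = 0) \<and>
        (\<forall>a. kills (?J - {j}) a \<longrightarrow> ?op i0 a v0 = smul c (?op (fst j) a (snd j)))"
    proof
      fix j assume "j \<in> ?J"
      then have "(fst j, snd j) \<in> ?J" by simp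
      from scalar[OF this] show "\<exists>c. (fst j \<noteq> i0 \<longrightarrow> c = 0) \<and>
        (\<forall>a. kills (?J - {j}) a \<longrightarrow> ?op i0 a v0 = smul c (?op (fst j) a (snd j)))"
        unfolding prod.collapse .
    qed
    then obtain c where c0: "\<And>j. j \<in> ?J \<Longrightarrow> fst j \<noteq> i0 \<Longrightarrow> c j = 0"
      and c: "\<And>j a. j \<in> ?J \<Longrightarrow> kills (?J - {j}) a \<Longrightarrow>
        ?op i0 a v0 = smul (c j) (?op (fst j) a (snd j))"
      by metis
    have "\<forall>j\<in>?J. \<exists>a. ?op (fst j) a (snd j) = snd j \<and> kills (?J - {j}) a"
    proof
      fix j assume "j \<in> ?J"
      then have j: "(fst j, snd j) \<in> ?J" by simp
      then have "snd j \<in> V (fst j)" using less.prems(2) by blast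
      from IH[OF j this] show "\<exists>a. ?op (fst j) a (snd j) = snd j \<and> kills (?J - {j}) a"
        unfolding prod.collapse .
    qed
    then obtain e where e: "\<And>j. j \<in> ?J \<Longrightarrow> ?op (fst j) (e j) (snd j) = snd j"
      "\<And>j. j \<in> ?J \<Longrightarrow> kills (?J - {j}) (e j)"
      by metis
    have finJ: "finite ?J" using less.prems by simp
    obtain b where b: "\<And>i v. ?op i b v = (\<Sum>j\<in>?J. ?op i (e j) v)"
      using group_algebra_op_sum[OF finJ] by metis
    (* the unit minus the sum of the elements e j: it kills every vector besides v0 *)
    let ?d = "(1, 0) # scale_list (-1) b"
    have d: "?op i ?d v = v - (\<Sum>j\<in>?J. ?op i (e j) v)" if "i \<in> I" "v \<in> V i" for i v
    proof -
      interpret smooth_rep smul "V i" "\<pi> i" using rep that by blast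
      show ?thesis using that by (simp add: pi_zero group_algebra_op_scale[OF vs] b)
    qed
    have "kills ?J ?d"
      unfolding kills_def
    proof (intro allI impI)
      fix i v assume iv: "(i, v) \<in> ?J"
      have "(\<Sum>j\<in>?J. ?op i (e j) v) = (\<Sum>j\<in>?J. if j = (i, v) then v else 0)"
      proof (rule sum.cong)
        fix j assume j: "j \<in> ?J"
        show "?op i (e j) v = (if j = (i, v) then v else 0)"
          using e(1)[OF j] e(2)[OF j] iv by (auto simp: kills_def)
      qed simp
      also have "\<dots> = v" using iv finJ by (subst sum.delta) auto
      finally show "?op i ?d v = 0" using d[of i v] less.prems iv by auto
    qed
    from kill[OF this] have "v0 = (\<Sum>j\<in>?J. ?op i0 (e j) v0)" using d[OF i0] by simp
    also have "\<dots> = (\<Sum>j\<in>?J. smul (c j) (snd j))" using c e by (intro sum.cong) auto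
    also have "\<dots> \<in> span {v. (i0, v) \<in> ?J}"
    proof (rule span_sum)
      fix j assume j: "j \<in> ?J"
      show "smul (c j) (snd j) \<in> span {v. (i0, v) \<in> ?J}"
      proof (cases "fst j = i0")
        case True
        then have "snd j \<in> {v. (i0, v) \<in> ?J}" using j by (cases j) auto
        then show ?thesis by (intro span_scale span_base)
      next
        case False
        then show ?thesis using c0[OF j] span_zero by simp
      qed
    qed
    also have "{v. (i0, v) \<in> ?J} = {v. (i0, v) \<in> J} - {v0}" by auto
    finally have "dependent {v. (i0, v) \<in> J}" using less.prems(4) unfolding dependent_def by blast
    with less.prems(3) show False by blast
  qed
  then obtain a0 where a0: "kills ?J a0" "?op i0 a0 v0 \<noteq> 0" by blast
  have "\<exists>a. kills ?J a \<and> ?op i0 a v0 = w"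
    by (rule R0.left_ideal_transitive[OF irr[OF i0(1)] i0(2), of "kills ?J" a0])
      (use a0 kills_closed less.prems in auto)
  then show ?case unfolding kills_def by blast
qed

section \<open>Coordinates and the invariant measure on a twisted space\<close>

text \<open>
  If an open set were null, finitely many of its translates would cover any compact set, so inner
  regularity would make the whole group null.
\<close>

lemma haar_open_pos:
  fixes \<mu> :: "'g::locally_profinite_group measure"
  assumes haar: "left_haar_measure \<mu>" and U: "open U" "x \<in> U"
  shows "emeasure \<mu> U > 0"
proof (rule ccontr)
  assume "\<not> emeasure \<mu> U > 0"
  then have U0: "emeasure \<mu> U = 0" by simp
  have sets: "sets \<mu> = sets borel" using haar by (simp add: left_haar_measure_def)
  have openT: "open ((+) g ` U)" for g
  proof -
    have "(+) g ` U = (\<lambda>x. - g + x) -` U" by (auto intro: rev_image_eqI)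
    moreover have "open ((\<lambda>x. - g + x) -` U)"
      by (rule open_vimage[OF U(1)]) (intro continuous_intros)
    ultimately show ?thesis by simp
  qed
  have T0: "(+) g ` U \<in> null_sets \<mu>" for g
  proof (rule null_setsI)
    have "U \<in> sets borel" using U(1) by simp
    with haar U0 show "emeasure \<mu> ((+) g ` U) = 0" by (simp add: left_haar_measure_def)
    show "(+) g ` U \<in> sets \<mu>" using openT by (simp add: sets)
  qed
  have "emeasure \<mu> K = 0" if K: "compact K" for K
  proof -
    have cov: "K \<subseteq> (\<Union>g\<in>K. (+) (g - x) ` U)"
    proof
      fix g assume "g \<in> K"
      moreover have "g = (g - x) + x" by simp
      ultimately show "g \<in> (\<Union>g\<in>K. (+) (g - x) ` U)" using U(2) by blast
    qed
    obtain F where F: "F \<subseteq> K" "finite F" "K \<subseteq> (\<Union>g\<in>F. (+) (g - x) ` U)"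
      using compactE_image[OF K, of K "\<lambda>g. (+) (g - x) ` U"] openT cov by blast
    have "(\<Union>g\<in>F. (+) (g - x) ` U) \<in> null_sets \<mu>"
      using F(2) T0 by (intro null_sets_UN') (auto intro: countable_finite)
    then have "emeasure \<mu> (\<Union>g\<in>F. (+) (g - x) ` U) = 0" by auto
    moreover have "emeasure \<mu> K \<le> emeasure \<mu> (\<Union>g\<in>F. (+) (g - x) ` U)"
      by (rule emeasure_mono[OF F(3)]) (use F(2) openT in \<open>auto simp: sets intro!: sets.finite_UN\<close>)
    ultimately show ?thesis by simp
  qed
  then have "(SUP K\<in>{K. compact K \<and> K \<subseteq> UNIV}. emeasure \<mu> K) = 0"
    by (auto intro!: antisym SUP_least)
  then have "emeasure \<mu> UNIV = 0"
    using haar unfolding left_haar_measure_def by (metis open_UNIV)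
  then show False using haar by (simp add: left_haar_measure_def)
qed

context twisted_space
begin

definition coord :: "'x \<Rightarrow> 'x \<Rightarrow> 'g" where
  "coord \<delta> = inv (\<lambda>g. act g \<delta>)"

lemma bij_orbit: "bij (\<lambda>g. act g \<delta>)"
proof -
  obtain f' where "homeomorphism UNIV UNIV (\<lambda>g. act g \<delta>) f'" using orbit_homeomorphism by blast
  then show ?thesis
    by (intro bij_betw_byWitness[where f' = f']) (auto simp: homeomorphism_def)
qed

lemma act_coord [simp]: "act (coord \<delta> x) \<delta> = x"
  unfolding coord_def by (rule surj_f_inv_f[OF bij_is_surj[OF bij_orbit]])

lemma coord_act [simp]: "coord \<delta> (act g \<delta>) = g"
  unfolding coord_def by (rule inv_f_f[OF bij_is_inj[OF bij_orbit]])

lemma coord_act_left: "coord \<delta> (act g x) = g + coord \<delta> x"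
  by (metis act_add act_coord coord_act)

lemma continuous_orbit: "continuous_on S (\<lambda>g. act g \<delta>)"
  and continuous_coord: "continuous_on UNIV (coord \<delta>)"
proof -
  obtain f' where f': "homeomorphism UNIV UNIV (\<lambda>g. act g \<delta>) f'" using orbit_homeomorphism by blast
  then show "continuous_on S (\<lambda>g. act g \<delta>)"
    by (auto simp: homeomorphism_def intro: continuous_on_subset)
  have "f' = coord \<delta>"
  proof
    show "f' x = coord \<delta> x" for x
      using f' coord_act[of \<delta> "f' x"] by (simp add: homeomorphism_def)
  qed
  with f' show "continuous_on UNIV (coord \<delta>)" by (simp add: homeomorphism_def)
qed

lemma continuous_act_left: "continuous_on UNIV (act g)"
proof -
  have "continuous_on UNIV ((\<lambda>(g, \<delta>). act g \<delta>) \<circ> (\<lambda>\<delta>. (g, \<delta>)))"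
    by (intro continuous_on_compose continuous_intros)
      (auto intro: continuous_on_subset[OF act_continuous])
  then show ?thesis by (simp add: o_def)
qed

lemma IntX_plus: "IntX \<delta> (g + h) = IntX \<delta> g + IntX \<delta> h"
  using IntX_automorphism[of \<delta>] by (simp add: top_group_automorphism_def)

lemma right_act_homeomorphism:
  "continuous_on UNIV (right_act act IntX \<delta>)"
  "\<exists>r'. continuous_on UNIV r' \<and> (\<forall>x. right_act act IntX \<delta> (r' x) = x) \<and> (\<forall>g. r' (right_act act IntX \<delta> g) = g)"
proof -
  obtain f' where f': "homeomorphism UNIV UNIV (IntX \<delta>) f'"
    using IntX_automorphism[of \<delta>] by (auto simp: top_group_automorphism_def)
  have "continuous_on UNIV ((\<lambda>g. act g \<delta>) \<circ> IntX \<delta>)"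
    using f' by (intro continuous_on_compose continuous_orbit) (auto simp: homeomorphism_def)
  then show "continuous_on UNIV (right_act act IntX \<delta>)" by (simp add: o_def right_act_def[abs_def])
  have "continuous_on UNIV (f' \<circ> coord \<delta>)"
    using f' continuous_coord
    by (intro continuous_on_compose) (auto simp: homeomorphism_def intro: continuous_on_subset)
  then show "\<exists>r'. continuous_on UNIV r' \<and> (\<forall>x. right_act act IntX \<delta> (r' x) = x) \<and> (\<forall>g. r' (right_act act IntX \<delta> g) = g)"
    using f' by (intro exI[of _ "f' \<circ> coord \<delta>"]) (auto simp: right_act_def homeomorphism_def)
qed

end

text \<open>
  The group acts from the left on points written \<open>\<delta>\<^sub>0 \<cdot> g\<close>, so \<open>h\<close> acts on the coordinate \<open>g\<close> as left
  translation by the preimage of \<open>h\<close> under \<open>IntX \<delta>\<^sub>0\<close>. Invariance of the measure on the twisted space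
  is thus inherited from the Haar measure.
\<close>

lemma (in twisted_space)
  fixes \<mu> :: "'g measure" and \<delta>\<^sub>0 :: 'x
  defines "\<nu> \<equiv> twisted_measure act IntX \<mu> \<delta>\<^sub>0"
  assumes haar: "left_haar_measure \<mu>"
  shows sets_twisted_measure: "sets \<nu> = sets borel"
    and twisted_measure_left_invariant:
      "A \<in> sets borel \<Longrightarrow> emeasure \<nu> (act h -` A) = emeasure \<nu> A"
    and twisted_measure_compact: "compact C \<Longrightarrow> C \<in> sets borel \<Longrightarrow> emeasure \<nu> C < \<infinity>"
proof -
  let ?r = "right_act act IntX \<delta>\<^sub>0"
  have sp: "sets \<mu> = sets borel" using haar by (simp add: left_haar_measure_def)
  then have space: "space \<mu> = UNIV" by (metis sets_eq_imp_space_eq space_borel)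
  have "?r \<in> borel_measurable borel"
    by (rule borel_measurable_continuous_onI[OF right_act_homeomorphism(1)])
  then have r: "?r \<in> measurable \<mu> borel" using sp by (metis measurable_cong_sets)
  show "sets \<nu> = sets borel" by (simp add: \<nu>_def twisted_measure_def)
  have em: "emeasure \<nu> A = emeasure \<mu> (?r -` A)" if "A \<in> sets borel" for A
    unfolding \<nu>_def twisted_measure_def using emeasure_distr[OF r that] space by simp
  have pre: "?r -` A \<in> sets borel" if "A \<in> sets borel" for A
    using measurable_sets[OF r that] space sp by simp
  obtain r' where r': "continuous_on UNIV r'" "\<And>x. ?r (r' x) = x" "\<And>g. r' (?r g) = g"
    using right_act_homeomorphism(2) by blast
  show "emeasure \<nu> (act h -` A) = emeasure \<nu> A" if A: "A \<in> sets borel"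
  proof -
    have "act h -` A \<in> sets borel"
      using measurable_sets[OF borel_measurable_continuous_onI[OF continuous_act_left] A]
      by simp
    then have "emeasure \<nu> (act h -` A) = emeasure \<mu> (?r -` act h -` A)" by (rule em)
    also have "?r -` act h -` A = (+) (- r' (act h \<delta>\<^sub>0)) ` (?r -` A)"
    proof -
      have "act h \<delta>\<^sub>0 = act (IntX \<delta>\<^sub>0 (r' (act h \<delta>\<^sub>0))) \<delta>\<^sub>0"
        using r'(2)[of "act h \<delta>\<^sub>0"] by (simp add: right_act_def)
      then have "IntX \<delta>\<^sub>0 (r' (act h \<delta>\<^sub>0)) = h" by (metis coord_act)
      then have *: "act h (?r g) = ?r (r' (act h \<delta>\<^sub>0) + g)" for g
        by (simp add: right_act_def act_add[symmetric] IntX_plus)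
      show ?thesis
      proof (intro equalityI subsetI)
        fix g assume "g \<in> ?r -` act h -` A"
        then have "r' (act h \<delta>\<^sub>0) + g \<in> ?r -` A" by (simp add: *)
        then show "g \<in> (+) (- r' (act h \<delta>\<^sub>0)) ` (?r -` A)"
          by (rule rev_image_eqI) simp
      next
        fix g assume "g \<in> (+) (- r' (act h \<delta>\<^sub>0)) ` (?r -` A)"
        then obtain g' where "?r g' \<in> A" "g = - r' (act h \<delta>\<^sub>0) + g'" by blast
        then show "g \<in> ?r -` act h -` A" by (simp add: *)
      qed
    qed
    also have "emeasure \<mu> \<dots> = emeasure \<mu> (?r -` A)"
      using haar pre[OF A] by (simp add: left_haar_measure_def)
    finally show ?thesis using em[OF A] by simp
  qed
  show "emeasure \<nu> C < \<infinity>" if C: "compact C" "C \<in> sets borel"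
  proof -
    have "compact (r' ` C)"
      by (rule compact_continuous_image[OF continuous_on_subset[OF r'(1)] C(1)]) simp
    moreover have "?r -` C = r' ` C"
    proof (intro equalityI subsetI)
      fix g assume "g \<in> ?r -` C"
      then show "g \<in> r' ` C" using r'(3)[of g] by (intro rev_image_eqI[of "?r g"]) auto
    qed (use r'(2) in auto)
    ultimately show ?thesis using em[OF C(2)] haar by (simp add: left_haar_measure_def)
  qed
qed

lemma twisted_measure_open_pos:
  fixes act :: "'g::locally_profinite_group \<Rightarrow> 'x::topological_space \<Rightarrow> 'x"
  assumes "twisted_space act IntX" and haar: "left_haar_measure \<mu>"
    and U: "open U" "x \<in> U"
  shows "emeasure (twisted_measure act IntX \<mu> \<delta>\<^sub>0) U > 0"
proof -
  interpret twisted_space act IntX by fact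
  let ?r = "right_act act IntX \<delta>\<^sub>0"
  have sp: "sets \<mu> = sets borel" using haar by (simp add: left_haar_measure_def)
  then have space: "space \<mu> = UNIV" by (metis sets_eq_imp_space_eq space_borel)
  have "?r \<in> borel_measurable borel"
    by (rule borel_measurable_continuous_onI[OF right_act_homeomorphism(1)])
  then have r: "?r \<in> measurable \<mu> borel" using sp by (metis measurable_cong_sets)
  obtain r' where r': "\<And>x. ?r (r' x) = x"
    using right_act_homeomorphism(2) by blast
  have "emeasure \<mu> (?r -` U) > 0"
    by (rule haar_open_pos[OF haar, of _ "r' x"])
      (use U r' in \<open>auto intro: open_vimage right_act_homeomorphism(1)\<close>)
  then show ?thesis
    unfolding twisted_measure_def using emeasure_distr[OF r, of U] U space by simp
qed

section \<open>Test functions on the twisted space\<close>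

text \<open>
  With \<open>\<gamma>\<close> the coordinate with respect to \<open>\<delta>\<^sub>1\<close>, this is the combination, with the coefficients of the
  list, of the characteristic functions of the sets \<open>h K \<cdot> \<delta>\<^sub>1\<close>.
\<close>

definition test_function ::
    "('x \<Rightarrow> 'g::group_add) \<Rightarrow> 'g set \<Rightarrow> (complex \<times> 'g) list \<Rightarrow> 'x \<Rightarrow> complex" where
  "test_function \<gamma> K a x = (\<Sum>(c, h)\<leftarrow>a. if - h + \<gamma> x \<in> K then c else 0)"

lemma test_function_Nil [simp]: "test_function \<gamma> K [] x = 0"
  and test_function_Cons [simp]: "test_function \<gamma> K ((c, h) # a) x =
    (if - h + \<gamma> x \<in> K then c else 0) + test_function \<gamma> K a x"
  by (simp_all add: test_function_def)

lemma character_zero: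
  assumes "group_character \<omega>"
  shows "\<omega> 0 = 1"
proof -
  have "\<omega> 0 * \<omega> 0 = \<omega> 0 * 1"
    using assms unfolding group_character_def by (metis add_0 mult.right_neutral)
  then show ?thesis using assms by (simp add: group_character_def)
qed

text \<open>
  The multiplicative group of complex numbers has no small subgroups: for \<open>z\<close> close to \<open>1\<close>, squaring
  multiplies the distance from \<open>1\<close> by \<open>\<bar>z + 1\<bar> \<ge> 3/2\<close>.
\<close>

lemma no_small_subgroups:
  assumes \<omega>: "group_character \<omega>" and K: "\<And>x y. x \<in> K \<Longrightarrow> y \<in> K \<Longrightarrow> x + y \<in> K"
    and small: "\<And>k. k \<in> K \<Longrightarrow> norm (\<omega> k - 1) \<le> 1/2" and k: "k \<in> K"
  shows "\<omega> k = 1"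
proof (rule ccontr)
  assume "\<omega> k \<noteq> 1"
  have grow: "(3/2) ^ n * norm (\<omega> k - 1) \<le> 1/2" if "k \<in> K" for n k
    using that
  proof (induction n arbitrary: k)
    case 0
    then show ?case using small by simp
  next
    case (Suc n)
    have "norm (2::complex) \<le> norm (\<omega> k + 1) + norm (1 - \<omega> k)"
      using norm_triangle_ineq[of "\<omega> k + 1" "1 - \<omega> k"] by simp
    then have "3/2 \<le> norm (\<omega> k + 1)"
      using small[OF Suc.prems] by (simp add: norm_minus_commute)
    then have "3/2 * norm (\<omega> k - 1) \<le> norm (\<omega> k + 1) * norm (\<omega> k - 1)"
      by (rule mult_right_mono) simp
    also have "\<dots> = norm ((\<omega> k + 1) * (\<omega> k - 1))" by (simp add: norm_mult)
    also have "(\<omega> k + 1) * (\<omega> k - 1) = \<omega> (k + k) - 1"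
      using \<omega> by (simp add: group_character_def algebra_simps)
    finally have "(3/2) ^ n * (3/2 * norm (\<omega> k - 1)) \<le> (3/2) ^ n * norm (\<omega> (k + k) - 1)"
      by (rule mult_left_mono) simp
    also have "\<dots> \<le> 1/2" using Suc K by blast
    finally show ?case by simp
  qed
  obtain n where "1 / norm (\<omega> k - 1) < (3/2) ^ n"
    using real_arch_pow[of "3/2"] by auto
  then have "1 < (3/2) ^ n * norm (\<omega> k - 1)"
    using \<open>\<omega> k \<noteq> 1\<close> by (simp add: divide_simps)
  with grow[OF k, of n] show False by simp
qed

locale invariant_subgroup_rep =
  omega_rep act IntX \<omega> smul V \<pi> T
  for act :: "'g::locally_profinite_group \<Rightarrow> 'x::topological_space \<Rightarrow> 'x"
    and IntX :: "'x \<Rightarrow> 'g \<Rightarrow> 'g"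
    and \<omega> :: "'g \<Rightarrow> complex"
    and smul :: "complex \<Rightarrow> 'v::ab_group_add \<Rightarrow> 'v"
    and V :: "'v set" and \<pi> :: "'g \<Rightarrow> 'v \<Rightarrow> 'v"
    and T :: "'x \<Rightarrow> 'v \<Rightarrow> 'v" +
  fixes \<mu> :: "'g measure" and \<delta>\<^sub>0 \<delta>\<^sub>1 :: 'x and K :: "'g set"
  assumes character: "group_character \<omega>"
    and haar: "left_haar_measure \<mu>"
    and K: "open_compact_subgroup K"
    and K_invariant: "IntX \<delta>\<^sub>1 ` K = K"
    and character_K: "k \<in> K \<Longrightarrow> \<omega> k = 1"
begin

abbreviation \<nu> :: "'x measure" where "\<nu> \<equiv> twisted_measure act IntX \<mu> \<delta>\<^sub>0"

text \<open>The open compact set \<open>h K \<cdot> \<delta>\<^sub>1\<close>.\<close>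

definition tile :: "'g \<Rightarrow> 'x set" where
  "tile h = {x. - h + coord \<delta>\<^sub>1 x \<in> K}"

abbreviation vol :: complex where "vol \<equiv> complex_of_real (measure \<nu> (tile 0))"

lemma T_closed: "v \<in> V \<Longrightarrow> T x v \<in> V"
  and T_scale: "v \<in> V \<Longrightarrow> T x (smul c v) = smul c (T x v)"
  and T_inj: "inj_on (T x) V"
  using T_aut[of x] by (auto simp: linear_iso_betw_def linear_betw_def bij_betw_def)

lemma K_zero: "0 \<in> K" and K_plus: "k \<in> K \<Longrightarrow> k' \<in> K \<Longrightarrow> k + k' \<in> K"
  and K_minus: "k \<in> K \<Longrightarrow> - k \<in> K"
  and K_open: "open K" and K_compact: "compact K"
  using K by (auto simp: open_compact_subgroup_def add_subgroup_def)

lemma T_left: "v \<in> V \<Longrightarrow> T (act g x) v = \<pi> g (T x v)"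
proof -
  assume v: "v \<in> V"
  have "IntX x 0 + IntX x 0 = IntX x 0 + 0" using IntX_plus[of x 0 0] by simp
  then have "IntX x 0 = 0" by (rule add_left_imp_eq)
  then show ?thesis
    using T_act[OF v, of g x 0] v
    by (simp add: right_act_def act_zero pi_zero character_zero[OF character])
qed

lemma T_coord: "v \<in> V \<Longrightarrow> T x v = \<pi> (coord \<delta>\<^sub>1 x) (T \<delta>\<^sub>1 v)"
  using T_left[of v "coord \<delta>\<^sub>1 x" \<delta>\<^sub>1] by simp

text \<open>
  This is where the invariance of \<open>K\<close> under \<open>IntX \<delta>\<^sub>1\<close> enters: \<open>k \<cdot> \<delta>\<^sub>1\<close> can be rewritten as \<open>\<delta>\<^sub>1 \<cdot> k'\<close> with
  \<open>k' \<in> K\<close>, and \<open>\<omega> k' = 1\<close>.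
\<close>

lemma T_fixed_vectors:
  assumes "v \<in> fixed_vectors K"
  shows "T \<delta>\<^sub>1 v \<in> fixed_vectors K"
proof -
  have v: "v \<in> V" "\<And>k. k \<in> K \<Longrightarrow> \<pi> k v = v" using assms by (auto simp: fixed_vectors_def)
  have "\<pi> k (T \<delta>\<^sub>1 v) = T \<delta>\<^sub>1 v" if "k \<in> K" for k
  proof -
    obtain k' where k': "k' \<in> K" "k = IntX \<delta>\<^sub>1 k'" using \<open>k \<in> K\<close> K_invariant by blast
    have "\<pi> k (T \<delta>\<^sub>1 v) = T (act 0 (right_act act IntX \<delta>\<^sub>1 k')) v"
      using T_left[OF v(1), of k \<delta>\<^sub>1] by (simp add: right_act_def k' act_zero)
    also have "\<dots> = T \<delta>\<^sub>1 v"
      using T_act[OF v(1), of 0 \<delta>\<^sub>1 k'] k' v by (simp add: character_K pi_zero T_closed)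
    finally show ?thesis .
  qed
  then show ?thesis using v T_closed by (simp add: fixed_vectors_def)
qed

lemma tile_translate: "tile h = act (- h) -` tile 0"
  by (auto simp: tile_def coord_act_left)

lemma tile_subgroup: "k \<in> K \<Longrightarrow> tile k = tile 0"
proof (intro equalityI subsetI)
  fix x assume k: "k \<in> K"
  show "x \<in> tile 0" if "x \<in> tile k"
    using K_plus[OF k, of "- k + coord \<delta>\<^sub>1 x"] that by (simp add: tile_def)
  show "x \<in> tile k" if "x \<in> tile 0"
    using K_plus[OF K_minus[OF k], of "coord \<delta>\<^sub>1 x"] that by (simp add: tile_def)
qed

lemma continuous_tile_coord: "continuous_on UNIV (\<lambda>x. - h + coord \<delta>\<^sub>1 x)"
  by (intro continuous_intros continuous_coord)

lemma open_tile: "open (tile h)"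
  using open_vimage[OF K_open continuous_tile_coord[of h]] by (simp add: tile_def vimage_def)

lemma closed_tile: "closed (tile h)"
  using closed_vimage[OF compact_imp_closed[OF K_compact] continuous_tile_coord[of h]]
  by (simp add: tile_def vimage_def)

lemma compact_tile: "compact (tile h)"
proof -
  have "compact ((\<lambda>g. act g \<delta>\<^sub>1) ` ((\<lambda>k. h + k) ` K))"
    by (intro compact_continuous_image continuous_orbit continuous_intros K_compact)
  moreover have "tile h = (\<lambda>g. act g \<delta>\<^sub>1) ` ((\<lambda>k. h + k) ` K)"
  proof (intro equalityI subsetI)
    fix x assume "x \<in> tile h"
    then have "- h + coord \<delta>\<^sub>1 x \<in> K" by (simp add: tile_def)
    moreover have "x = act (h + (- h + coord \<delta>\<^sub>1 x)) \<delta>\<^sub>1" by simp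
    ultimately show "x \<in> (\<lambda>g. act g \<delta>\<^sub>1) ` ((\<lambda>k. h + k) ` K)" by blast
  qed (auto simp: tile_def)
  ultimately show ?thesis by simp
qed

lemma emeasure_tile: "emeasure \<nu> (tile h) < \<infinity>"
  by (rule twisted_measure_compact[OF haar compact_tile]) (simp add: open_tile)

lemma vol_nonzero: "vol \<noteq> 0"
proof -
  have "\<delta>\<^sub>1 \<in> tile 0"
    using K_zero coord_act[of \<delta>\<^sub>1 0] by (simp add: tile_def act_zero)
  then have "emeasure \<nu> (tile 0) > 0"
    by (rule twisted_measure_open_pos[OF twisted_space_axioms haar open_tile])
  then have "measure \<nu> (tile 0) > 0"
    using emeasure_tile[of 0] by (simp add: measure_def enn2real_positive_iff)
  then show ?thesis by simp
qed

definition cutoff :: "'g \<Rightarrow> 'v \<Rightarrow> 'x \<Rightarrow> 'v" where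
  "cutoff h v x = (if x \<in> tile h then T x v else 0)"

lemma open_level:
  assumes v: "v \<in> V"
  shows "open {x. T x v = w}"
proof (subst open_subopen, clarify)
  fix x assume w: "w = T x v"
  let ?f = "\<lambda>y. - coord \<delta>\<^sub>1 x + coord \<delta>\<^sub>1 y"
  let ?u = "T \<delta>\<^sub>1 v"
  have u: "?u \<in> V" using v by (rule T_closed)
  have "open (?f -` {g. \<pi> g ?u = ?u})"
    by (rule open_vimage[OF smooth[OF u] continuous_tile_coord])
  moreover have "T y v = T x v" if "\<pi> (?f y) ?u = ?u" for y
  proof -
    have "\<pi> (coord \<delta>\<^sub>1 y) ?u = \<pi> (coord \<delta>\<^sub>1 x + ?f y) ?u" by simp
    also have "\<dots> = \<pi> (coord \<delta>\<^sub>1 x) (\<pi> (?f y) ?u)" by (rule \<pi>_add[OF u])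
    also have "\<dots> = \<pi> (coord \<delta>\<^sub>1 x) ?u" by (simp only: that)
    finally show ?thesis by (simp only: T_coord[OF v, symmetric])
  qed
  moreover have "x \<in> ?f -` {g. \<pi> g ?u = ?u}" using u by (simp add: pi_zero)
  ultimately show "\<exists>U. open U \<and> x \<in> U \<and> U \<subseteq> {y. T y v = T x v}" by blast
qed

lemma cutoff_in_V: "v \<in> V \<Longrightarrow> cutoff h v x \<in> V"
  by (simp add: cutoff_def T_closed subspace_0[OF subspace_V])

lemma simple_integrable_cutoff:
  assumes v: "v \<in> V"
  shows "simple_integrable \<nu> (cutoff h v)"
  unfolding simple_integrable_def
proof (intro conjI allI impI)
  obtain D where D: "D \<subseteq> tile h" "finite D" "tile h \<subseteq> (\<Union>y\<in>D. {x. T x v = T y v})"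
    using compactE_image[OF compact_tile[of h], of "tile h" "\<lambda>y. {x. T x v = T y v}"]
      open_level[OF v] by blast
  have "range (cutoff h v) \<subseteq> insert 0 ((\<lambda>y. T y v) ` D)" using D(3) by (auto simp: cutoff_def)
  then show "finite (range (cutoff h v))" by (rule finite_subset) (use D in simp)
  have vim: "cutoff h v -` {w} =
      tile h \<inter> {x. T x v = w} \<union> (if w = 0 then - tile h else {})" for w
    by (auto simp: cutoff_def split: if_splits)
  have "open (cutoff h v -` {w})" for w
    unfolding vim using open_tile[of h] closed_tile[of h] open_level[OF v, of w]
    by (auto intro!: open_Un open_Int)
  then show "cutoff h v -` {w} \<in> sets \<nu>" for w
    by (simp add: sets_twisted_measure[OF haar])
  show "emeasure \<nu> (cutoff h v -` {w}) < \<infinity>" if "w \<noteq> 0" for w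
  proof -
    have "cutoff h v -` {w} \<subseteq> tile h" using \<open>w \<noteq> 0\<close> unfolding vim by auto
    then have "emeasure \<nu> (cutoff h v -` {w}) \<le> emeasure \<nu> (tile h)"
      using open_tile[of h] by (intro emeasure_mono) (simp_all add: sets_twisted_measure[OF haar])
    then show ?thesis using emeasure_tile[of h] by (rule le_less_trans)
  qed
qed

lemma lc_integral_as_sum:
  assumes "simple_integrable \<nu> F"
  shows "lc_integral smul \<nu> F =
    (\<Sum>b\<in>range F. smul (complex_of_real (measure \<nu> (F -` {b}))) b)"
  using lc_integral_coarsen[OF vector_space_axioms, of F "\<lambda>b. b" \<nu>] assms
  by (simp add: simple_integrable_def)

lemma lc_integral_in_V:
  assumes "simple_integrable \<nu> F" "range F \<subseteq> V"
  shows "lc_integral smul \<nu> F \<in> V"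
  unfolding lc_integral_as_sum[OF assms(1)]
  using assms(2) by (intro subspace_sum[OF subspace_V] subspace_scale[OF subspace_V]) auto

lemma lc_integral_pi:
  assumes F: "simple_integrable \<nu> F" "range F \<subseteq> V"
  shows "lc_integral smul \<nu> (\<lambda>x. \<pi> h (F x)) = \<pi> h (lc_integral smul \<nu> F)"
proof -
  have "lc_integral smul \<nu> (\<lambda>x. \<pi> h (F x)) =
      (\<Sum>b\<in>range F. smul (complex_of_real (measure \<nu> (F -` {b}))) (\<pi> h b))"
  proof (rule lc_integral_coarsen[OF vector_space_axioms])
    fix b assume "\<pi> h b \<noteq> 0"
    then have "b \<noteq> 0" using pi_zero_vector by auto
    then show "F -` {b} \<in> sets \<nu> \<and> emeasure \<nu> (F -` {b}) < \<infinity>"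
      using F(1) by (simp add: simple_integrable_def)
  qed (use F(1) in \<open>simp add: simple_integrable_def\<close>)
  also have "\<dots> = (\<Sum>b\<in>range F. \<pi> h (smul (complex_of_real (measure \<nu> (F -` {b}))) b))"
    using F(2) by (intro sum.cong) (auto simp: pi_scale)
  also have "\<dots> = \<pi> h (lc_integral smul \<nu> F)"
    unfolding lc_integral_as_sum[OF F(1)]
    using F(2) subspace_scale[OF subspace_V] by (subst pi_sum) auto
  finally show ?thesis .
qed

lemma lc_integral_translate:
  assumes F: "simple_integrable \<nu> F"
  shows "lc_integral smul \<nu> (\<lambda>x. F (act h x)) = lc_integral smul \<nu> F"
proof -
  have "act h (act (- h) x) = x" for x by (simp add: act_add[symmetric] act_zero)
  then have "surj (act h)" by (rule surjI)
  moreover have "range (\<lambda>x. F (act h x)) = F ` range (act h)" by auto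
  ultimately have "range (\<lambda>x. F (act h x)) = range F" by simp
  moreover have "measure \<nu> ((\<lambda>x. F (act h x)) -` {w}) = measure \<nu> (F -` {w})" for w
  proof -
    have "F -` {w} \<in> sets borel"
      using F by (simp add: simple_integrable_def sets_twisted_measure[OF haar])
    from twisted_measure_left_invariant[OF haar this]
    have "emeasure \<nu> (act h -` (F -` {w})) = emeasure \<nu> (F -` {w})" .
    moreover have "act h -` (F -` {w}) = (\<lambda>x. F (act h x)) -` {w}" by auto
    ultimately show ?thesis by (simp add: measure_def)
  qed
  ultimately show ?thesis by (simp add: lc_integral_def)
qed

text \<open>
  This vector is the projection of \<open>T \<delta>\<^sub>1 v\<close> to the vectors fixed by \<open>K\<close>, the mean of its translates
  under \<open>K\<close>. As it is written as an integral over the twisted space, its invariance under \<open>K\<close> follows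
  from that of the measure.
\<close>

definition avg :: "'v \<Rightarrow> 'v" where
  "avg v = smul (inverse vol) (lc_integral smul \<nu> (cutoff 0 v))"

lemma avg_in_V: "v \<in> V \<Longrightarrow> avg v \<in> V"
  unfolding avg_def
  by (intro subspace_scale[OF subspace_V] lc_integral_in_V simple_integrable_cutoff)
    (auto simp: cutoff_in_V)

text \<open>
  The integrand over \<open>tile h\<close> is the one over \<open>tile 0\<close>, translated by \<open>h\<close> and followed by \<open>\<pi> h\<close>.
\<close>

lemma lc_integral_cutoff:
  assumes v: "v \<in> V"
  shows "lc_integral smul \<nu> (cutoff h v) = smul vol (\<pi> h (avg v))"
proof -
  have "cutoff h v = (\<lambda>x. \<pi> h (cutoff 0 v (act (- h) x)))"
  proof
    fix x
    have "\<pi> h (T (act (- h) x) v) = T x v" using v by (simp add: T_left pi_minus T_closed)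
    then show "cutoff h v x = \<pi> h (cutoff 0 v (act (- h) x))"
      by (simp add: cutoff_def tile_translate[of h] pi_zero_vector)
  qed
  moreover have "lc_integral smul \<nu> (\<lambda>x. \<pi> h (cutoff 0 v x)) = \<pi> h (lc_integral smul \<nu> (cutoff 0 v))"
    using v by (intro lc_integral_pi simple_integrable_cutoff) (auto simp: cutoff_in_V)
  moreover have "simple_integrable \<nu> (\<lambda>x. \<pi> h (cutoff 0 v x))"
  proof -
    have F: "simple_integrable \<nu> (cutoff 0 v)" using v by (rule simple_integrable_cutoff)
    have "range (\<lambda>x. \<pi> h (cutoff 0 v x)) = \<pi> h ` range (cutoff 0 v)" by auto
    moreover have "(\<lambda>x. \<pi> h (cutoff 0 v x)) -` {w} =
        (if w \<in> V then cutoff 0 v -` {\<pi> (- h) w} else {})" for w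
      using cutoff_in_V[OF v] by (auto simp: pi_minus pi_closed)
    moreover have "\<pi> (- h) w \<noteq> 0" if "w \<in> V" "w \<noteq> 0" for w
      using that pi_minus(2)[of w h] pi_zero_vector by metis
    ultimately show ?thesis using F by (auto simp: simple_integrable_def)
  qed
  ultimately have "lc_integral smul \<nu> (cutoff h v) = \<pi> h (lc_integral smul \<nu> (cutoff 0 v))"
    using lc_integral_translate[of "\<lambda>x. \<pi> h (cutoff 0 v x)" "- h"] by simp
  also have "lc_integral smul \<nu> (cutoff 0 v) = smul vol (avg v)"
    using vol_nonzero by (simp add: avg_def)
  finally show ?thesis using v by (simp add: pi_scale avg_in_V)
qed

lemma avg_fixed: "v \<in> V \<Longrightarrow> avg v \<in> fixed_vectors K"
proof -
  assume v: "v \<in> V"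
  have "\<pi> k (avg v) = avg v" if "k \<in> K" for k
  proof -
    have "cutoff k v = cutoff 0 v" using tile_subgroup[OF that] by (simp add: cutoff_def fun_eq_iff)
    then have "smul vol (\<pi> k (avg v)) = smul vol (\<pi> 0 (avg v))"
      using lc_integral_cutoff[OF v, of k] lc_integral_cutoff[OF v, of 0] by argo
    then have "\<pi> k (avg v) = \<pi> 0 (avg v)" using vol_nonzero scale_left_imp_eq by blast
    then show ?thesis using v by (simp add: pi_zero avg_in_V)
  qed
  then show ?thesis using avg_in_V[OF v] by (simp add: fixed_vectors_def)
qed

lemma avg_eq:
  assumes "v \<in> fixed_vectors K"
  shows "avg v = T \<delta>\<^sub>1 v"
proof -
  have v: "v \<in> V" using assms by (simp add: fixed_vectors_def)
  let ?w = "\<lambda>b. if b then T \<delta>\<^sub>1 v else 0"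
  have "cutoff 0 v = (\<lambda>x. ?w (x \<in> tile 0))"
  proof
    fix x
    have "T x v = T \<delta>\<^sub>1 v" if "x \<in> tile 0"
      using T_fixed_vectors[OF assms] that T_coord[OF v, of x]
      by (simp add: fixed_vectors_def tile_def)
    then show "cutoff 0 v x = ?w (x \<in> tile 0)" by (simp add: cutoff_def)
  qed
  moreover have "lc_integral smul \<nu> (\<lambda>x. ?w (x \<in> tile 0)) =
      (\<Sum>b\<in>range (\<lambda>x. x \<in> tile 0).
        smul (complex_of_real (measure \<nu> ((\<lambda>x. x \<in> tile 0) -` {b}))) (?w b))"
  proof (rule lc_integral_coarsen[OF vector_space_axioms])
    fix b assume "?w b \<noteq> 0"
    then have "(\<lambda>x. x \<in> tile 0) -` {b} = tile 0" by (auto split: if_splits)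
    then show "(\<lambda>x. x \<in> tile 0) -` {b} \<in> sets \<nu> \<and> emeasure \<nu> ((\<lambda>x. x \<in> tile 0) -` {b}) < \<infinity>"
      using emeasure_tile[of 0] open_tile[of 0] by (simp add: sets_twisted_measure[OF haar])
  qed simp
  moreover have "\<dots> = (\<Sum>b\<in>range (\<lambda>x. x \<in> tile 0). if b = True then smul vol (T \<delta>\<^sub>1 v) else 0)"
    by (rule sum.cong) (auto simp: vimage_def)
  moreover have "\<dots> = smul vol (T \<delta>\<^sub>1 v)"
  proof -
    have "tile 0 \<noteq> {}" using vol_nonzero by auto
    then have "True \<in> range (\<lambda>x. x \<in> tile 0)" by (auto simp: image_iff)
    then show ?thesis by (subst sum.delta) auto
  qed
  ultimately show ?thesis using vol_nonzero by (simp add: avg_def)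
qed

text \<open>
  The key formula: up to the constant \<open>vol\<close>, the operator of a test function is the projection of
  \<open>T \<delta>\<^sub>1\<close> to the vectors fixed by \<open>K\<close>, followed by the element \<open>a\<close> of the group algebra. Its trace can
  therefore be prescribed by choosing the action of \<open>a\<close> on a finite-dimensional space.
\<close>

lemma lc_integral_test_function:
  assumes v: "v \<in> V"
  shows "lc_integral smul \<nu> (\<lambda>x. smul (test_function (coord \<delta>\<^sub>1) K a x) (T x v)) =
    smul vol (op a (avg v))"
proof -
  let ?F = "\<lambda>a x. smul (test_function (coord \<delta>\<^sub>1) K a x) (T x v)"
  have "simple_integrable \<nu> (?F a) \<and> lc_integral smul \<nu> (?F a) = smul vol (op a (avg v))"
  proof (induction a)
    case Nil
    show ?case
      by (simp add: simple_integrable_def lc_integral_def vimage_def sets_twisted_measure[OF haar])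
  next
    case (Cons p a)
    obtain c h where p: "p = (c, h)" by force
    have eq: "?F (p # a) = (\<lambda>x. smul c (cutoff h v x) + ?F a x)"
      by (auto simp: p cutoff_def tile_def scale_left_distrib)
    note F = simple_integrable_cutoff[OF v, of h]
    note cF = simple_integrable_scale[OF vector_space_axioms F, of c]
    show ?case
      unfolding eq
      using simple_integrable_add[OF vector_space_axioms cF, of "?F a"]
        lc_integral_add[OF vector_space_axioms cF, of "?F a"] Cons
      by (simp add: p lc_integral_scale[OF vector_space_axioms F] lc_integral_cutoff[OF v]
          scale_right_distrib mult.commute)
  qed
  then show ?thesis by blast
qed

lemma test_function_Cc_infty: "test_function (coord \<delta>\<^sub>1) K a \<in> Cc_infty"
proof -
  have loc: "\<exists>U. open U \<and> x \<in> U \<and> (\<forall>y\<in>U. test_function (coord \<delta>\<^sub>1) K a y = test_function (coord \<delta>\<^sub>1) K a x)" for x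
  proof (induction a)
    case Nil
    show ?case by (rule exI[of _ UNIV]) simp
  next
    case (Cons p a)
    obtain c h where p: "p = (c, h)" by force
    obtain U where U: "open U" "x \<in> U"
      "\<forall>y\<in>U. test_function (coord \<delta>\<^sub>1) K a y = test_function (coord \<delta>\<^sub>1) K a x"
      using Cons by blast
    let ?W = "if x \<in> tile h then tile h else - tile h"
    have "open ?W" using open_tile closed_tile by auto
    show ?case
    proof (intro exI[of _ "U \<inter> ?W"] conjI ballI)
      show "open (U \<inter> ?W)" using U(1) \<open>open ?W\<close> by (rule open_Int)
      show "x \<in> U \<inter> ?W" using U(2) by simp
      fix y assume y: "y \<in> U \<inter> ?W"
      then have "y \<in> tile h \<longleftrightarrow> x \<in> tile h" by (simp split: if_splits)
      then show "test_function (coord \<delta>\<^sub>1) K (p # a) y = test_function (coord \<delta>\<^sub>1) K (p # a) x"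
        using U(3) y by (simp add: p tile_def)
    qed
  qed
  have supp: "{x. test_function (coord \<delta>\<^sub>1) K a x \<noteq> 0} \<subseteq> (\<Union>h\<in>snd ` set a. tile h)"
    by (induction a) (auto simp: tile_def split: if_splits)
  have "closed (\<Union>h\<in>snd ` set a. tile h)" by (intro closed_UN) (auto simp: closed_tile)
  then have "closure {x. test_function (coord \<delta>\<^sub>1) K a x \<noteq> 0} \<subseteq> (\<Union>h\<in>snd ` set a. tile h)"
    using supp by (rule closure_minimal[rotated])
  then have eq: "closure {x. test_function (coord \<delta>\<^sub>1) K a x \<noteq> 0} =
      (\<Union>h\<in>snd ` set a. tile h) \<inter> closure {x. test_function (coord \<delta>\<^sub>1) K a x \<noteq> 0}"
    by blast
  have "compact (\<Union>h\<in>snd ` set a. tile h)" by (intro compact_UN) (auto simp: compact_tile)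
  then have "compact (closure {x. test_function (coord \<delta>\<^sub>1) K a x \<noteq> 0})"
    by (subst eq) (rule compact_Int_closed[OF _ closed_closure])
  moreover have "locally_constant (test_function (coord \<delta>\<^sub>1) K a)"
    unfolding locally_constant_def constant_on_def
  proof
    show "\<exists>U. open U \<and> x \<in> U \<and> (\<exists>y. \<forall>z\<in>U. test_function (coord \<delta>\<^sub>1) K a z = y)" for x
      using loc[of x] by meson
  qed
  ultimately show ?thesis by (simp add: Cc_infty_def)
qed

lemma Theta_test_function_zero:
  assumes "\<And>y. y \<in> fixed_vectors K \<Longrightarrow> op a y = 0"
  shows "Theta smul V \<nu> T (test_function (coord \<delta>\<^sub>1) K a) = 0"
  unfolding Theta_def
proof (rule finite_rank_trace_zero[OF vector_space_axioms])
  show "(\<lambda>v. lc_integral smul \<nu> (\<lambda>x. smul (test_function (coord \<delta>\<^sub>1) K a x) (T x v))) ` V = {0}"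
    using subspace_0[OF subspace_V] assms avg_fixed
    by (force simp: lc_integral_test_function)
qed

lemma Theta_test_function_line:
  assumes w: "w \<in> fixed_vectors K" "w \<noteq> 0" and aw: "op a (T \<delta>\<^sub>1 w) = w"
    and line: "\<And>y. y \<in> fixed_vectors K \<Longrightarrow> op a y \<in> span {w}"
  shows "Theta smul V \<nu> T (test_function (coord \<delta>\<^sub>1) K a) = vol"
  unfolding Theta_def
proof (rule finite_rank_trace_line[OF vector_space_axioms w(2)])
  let ?A = "\<lambda>v. lc_integral smul \<nu> (\<lambda>x. smul (test_function (coord \<delta>\<^sub>1) K a x) (T x v))"
  have wV: "w \<in> V" using w by (simp add: fixed_vectors_def)
  have spanK: "span {w} \<subseteq> fixed_vectors K"
    using w(1) subspace_fixed_vectors by (intro span_minimal) auto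
  then have spanV: "span {w} \<subseteq> V" by (auto simp: fixed_vectors_def)
  show eig: "?A v = smul vol v" if v: "v \<in> span {w}" for v
  proof -
    obtain s where s: "v = smul s w" using v by (auto simp: span_singleton)
    have "avg v = smul s (T \<delta>\<^sub>1 w)"
      using avg_eq[of v] spanK v s T_scale[OF wV] by auto
    then have "op a (avg v) = v" using aw s wV by (simp add: op_scale T_closed)
    then show ?thesis using spanV v by (simp add: lc_integral_test_function subset_iff)
  qed
  show "?A ` V = span {w}"
  proof (intro equalityI subsetI)
    fix x assume "x \<in> ?A ` V"
    then show "x \<in> span {w}"
      using line avg_fixed by (auto simp: lc_integral_test_function intro: span_scale)
  next
    fix x assume x: "x \<in> span {w}"
    let ?v = "smul (inverse vol) x"
    have "?v \<in> span {w}" using x by (rule span_scale)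
    then have "x = ?A ?v" "?v \<in> V" using eig[of ?v] vol_nonzero spanV by auto
    then show "x \<in> ?A ` V" by blast
  qed
qed

end

section \<open>Linear independence\<close>

lemma schur_admissible:
  fixes \<pi> :: "'g::locally_profinite_group \<Rightarrow> 'v::ab_group_add \<Rightarrow> 'v"
  assumes "smooth_rep smul V \<pi>" "smooth_rep.admissible smul V \<pi>" "smooth_rep.irreducible smul V \<pi>"
    and f: "linear_betw smul V V f" "\<And>g v. v \<in> V \<Longrightarrow> f (\<pi> g v) = \<pi> g (f v)"
  shows "\<exists>c. \<forall>v\<in>V. f v = smul c v"
proof -
  interpret smooth_rep smul V \<pi> by fact
  obtain v where v: "v \<in> V" "v \<noteq> 0"
    using assms(3) subspace_0[OF subspace_V] unfolding irreducible_def by blast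
  obtain K where K: "open_compact_subgroup K" "K \<subseteq> {g. \<pi> g v = v}"
    using open_compact_subgroup_in_nbhd[OF smooth[OF v(1)]] pi_zero[OF v(1)] by blast
  obtain B where B: "finite B" "fixed_vectors K = span B"
    using assms(2) K(1) unfolding admissible_def by blast
  have "v \<in> fixed_vectors K" using v K by (auto simp: fixed_vectors_def)
  then show ?thesis using schur_scalar[OF assms(3) B(1) _ _ v(2) f] B(2) by blast
qed

lemma (in smooth_rep) op_span:
  assumes C: "C \<subseteq> V" and W: "subspace W" and CW: "\<And>v. v \<in> C \<Longrightarrow> op a v \<in> W"
    and y: "y \<in> span C"
  shows "op a y \<in> W"
proof -
  have V0: "0 \<in> V" by (rule subspace_0[OF subspace_V])
  have "op a 0 = 0" using op_scale[OF V0, of a 0] by simp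
  then have "subspace {y \<in> V. op a y \<in> W}"
    using V0 W subspace_V unfolding subspace_def by (simp add: op_add op_scale)
  then have "span C \<subseteq> {y \<in> V. op a y \<in> W}" using C CW by (intro span_minimal) auto
  then show ?thesis using y by blast
qed

theorem mainTheorem14:
  fixes act :: "'g::locally_profinite_group \<Rightarrow> 'x::topological_space \<Rightarrow> 'x"
    and IntX :: "'x \<Rightarrow> 'g \<Rightarrow> 'g"
    and \<omega> :: "'g \<Rightarrow> complex"
    and \<mu> :: "'g measure" and \<delta>\<^sub>0 :: 'x
    and smul :: "complex \<Rightarrow> 'v::ab_group_add \<Rightarrow> 'v"
    and n :: nat
    and V :: "nat \<Rightarrow> 'v set"
    and \<pi> :: "nat \<Rightarrow> 'g \<Rightarrow> 'v \<Rightarrow> 'v"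
    and T :: "nat \<Rightarrow> 'x \<Rightarrow> 'v \<Rightarrow> 'v"
  assumes "twisted_space act IntX"
    and "group_character \<omega>"
    and "left_haar_measure \<mu>"
    and "\<exists>\<delta>\<^sub>1 \<K>. fundamental_nbhds_0 \<K> \<and>
           (\<forall>K\<in>\<K>. open_compact_subgroup K \<and> IntX \<delta>\<^sub>1 ` K = K)"
    and "vector_space smul"
    and "\<And>i. i \<in> {1..n} \<Longrightarrow> omega_rep act IntX \<omega> smul (V i) (\<pi> i) (T i)"
    and "\<And>i. i \<in> {1..n} \<Longrightarrow> smooth_rep.admissible smul (V i) (\<pi> i)"
    and "\<And>i. i \<in> {1..n} \<Longrightarrow> smooth_rep.irreducible smul (V i) (\<pi> i)"
    and "\<And>i j. i \<in> {1..n} \<Longrightarrow> j \<in> {1..n} \<Longrightarrow> i \<noteq> j \<Longrightarrow>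
           \<not> rep_isomorphic smul (V i) (\<pi> i) (V j) (\<pi> j)"
  shows "lin_indep_distributions {1..n}
           (\<lambda>i. Theta smul (V i) (twisted_measure act IntX \<mu> \<delta>\<^sub>0) (T i))"
  unfolding lin_indep_distributions_def
proof (intro allI impI ballI)
  fix c i0
  let ?\<nu> = "twisted_measure act IntX \<mu> \<delta>\<^sub>0"
  assume vanish: "\<forall>\<phi>\<in>Cc_infty. (\<Sum>i\<in>{1..n}. c i * Theta smul (V i) ?\<nu> (T i) \<phi>) = 0"
    and i0: "i0 \<in> {1..n}"
  note \<omega> = assms(2) and haar = assms(3) and rep = assms(6) and adm = assms(7) and irr = assms(8)
  interpret vector_space smul by (rule assms(5))
  have smooth: "smooth_rep smul (V i) (\<pi> i)" if "i \<in> {1..n}" for i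
    using rep[OF that] by (simp add: omega_rep_def)
  obtain \<delta>\<^sub>1 \<K> where \<K>: "fundamental_nbhds_0 \<K>"
    "\<And>K. K \<in> \<K> \<Longrightarrow> open_compact_subgroup K \<and> IntX \<delta>\<^sub>1 ` K = K"
    using assms(4) by metis

  interpret R0: smooth_rep smul "V i0" "\<pi> i0" by (rule smooth[OF i0])
  obtain w where w: "w \<in> V i0" "w \<noteq> 0"
  proof -
    have "V i0 \<noteq> {0}" using irr[OF i0] R0.irreducible_def by simp
    then show thesis using that subspace_0[OF R0.subspace_V] by blast
  qed
  have "\<exists>K\<in>\<K>. K \<subseteq> {g. \<pi> i0 g w = w} \<inter> \<omega> -` ball 1 (1/2)"
  proof -
    have "open (\<omega> -` ball 1 (1/2))"
      using \<omega> by (intro open_vimage) (auto simp: group_character_def)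
    then have "open ({g. \<pi> i0 g w = w} \<inter> \<omega> -` ball 1 (1/2))"
      using R0.smooth[OF w(1)] by (intro open_Int)
    moreover have "0 \<in> {g. \<pi> i0 g w = w} \<inter> \<omega> -` ball 1 (1/2)"
      using R0.pi_zero[OF w(1)] character_zero[OF \<omega>] by simp
    ultimately show ?thesis using \<K>(1) unfolding fundamental_nbhds_0_def by blast
  qed
  then obtain K where K\<K>: "K \<in> \<K>" and K_sub: "K \<subseteq> {g. \<pi> i0 g w = w} \<inter> \<omega> -` ball 1 (1/2)"
    by blast
  have K: "open_compact_subgroup K" "IntX \<delta>\<^sub>1 ` K = K" using \<K>(2)[OF K\<K>] by auto
  have wK: "w \<in> R0.fixed_vectors K" using w K_sub by (auto simp: R0.fixed_vectors_def)
  have \<omega>K: "\<omega> k = 1" if "k \<in> K" for k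
  proof (rule no_small_subgroups[OF \<omega> _ _ that])
    show "x + y \<in> K" if "x \<in> K" "y \<in> K" for x y
      using K(1) that by (simp add: open_compact_subgroup_def add_subgroup_def)
    show "norm (\<omega> k - 1) \<le> 1/2" if "k \<in> K" for k
      using K_sub that by (force simp: dist_norm norm_minus_commute)
  qed
  have setting: "invariant_subgroup_rep act IntX \<omega> smul (V i) (\<pi> i) (T i) \<mu> \<delta>\<^sub>1 K"
    if "i \<in> {1..n}" for i
    using rep[OF that] \<omega> haar K \<omega>K
    by (simp add: invariant_subgroup_rep_def invariant_subgroup_rep_axioms_def)
  interpret S0: invariant_subgroup_rep act IntX \<omega> smul "V i0" "\<pi> i0" "T i0" \<mu> \<delta>\<^sub>0 \<delta>\<^sub>1 K
    by (rule setting[OF i0])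

  (* a shall send u to w and kill the other basis vectors, so that w becomes an eigenvector *)
  define u where "u = T i0 \<delta>\<^sub>1 w"
  have uK: "u \<in> R0.fixed_vectors K" unfolding u_def by (rule S0.T_fixed_vectors[OF wK])
  have "T i0 \<delta>\<^sub>1 0 = 0" using S0.T_scale[of 0 \<delta>\<^sub>1 0] subspace_0[OF R0.subspace_V] by simp
  then have u0: "u \<noteq> 0"
    using S0.T_inj[of \<delta>\<^sub>1] w subspace_0[OF R0.subspace_V] by (auto simp: u_def inj_on_def)

  have fin: "\<exists>B. finite B \<and> smooth_rep.fixed_vectors (V i) (\<pi> i) K = span B" if "i \<in> {1..n}" for i
    using adm[OF that] K(1) smooth_rep.admissible_def[OF smooth[OF that]] by blast
  have "\<exists>C. finite C \<and> independent C \<and> C \<subseteq> smooth_rep.fixed_vectors (V i) (\<pi> i) K \<and>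
      smooth_rep.fixed_vectors (V i) (\<pi> i) K \<subseteq> span C \<and> (i = i0 \<longrightarrow> u \<in> C)"
    if i: "i \<in> {1..n}" for i
  proof -
    obtain B where B: "finite B" "smooth_rep.fixed_vectors (V i) (\<pi> i) K = span B"
      using fin[OF i] by blast
    let ?S = "if i = i0 then {u} else {}"
    have "?S \<subseteq> smooth_rep.fixed_vectors (V i) (\<pi> i) K" "independent ?S"
      using uK u0 independent_empty by auto
    then obtain D where "?S \<subseteq> D" "D \<subseteq> smooth_rep.fixed_vectors (V i) (\<pi> i) K" "finite D"
      "independent D" "smooth_rep.fixed_vectors (V i) (\<pi> i) K \<subseteq> span D"
      using finite_basis_of_finite_span[OF B(1)] B(2) by blast
    then show ?thesis by (intro exI[of _ D]) auto
  qed
  then obtain C where C: "\<And>i. i \<in> {1..n} \<Longrightarrow> finite (C i)" "\<And>i. i \<in> {1..n} \<Longrightarrow> independent (C i)"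
    "\<And>i. i \<in> {1..n} \<Longrightarrow> C i \<subseteq> smooth_rep.fixed_vectors (V i) (\<pi> i) K"
    "\<And>i. i \<in> {1..n} \<Longrightarrow> smooth_rep.fixed_vectors (V i) (\<pi> i) K \<subseteq> span (C i)" "u \<in> C i0"
    using i0 by metis
  let ?J = "Sigma {1..n} C"
  have "\<exists>a. group_algebra_op smul (\<pi> i0) a u = w \<and>
    (\<forall>i v. (i, v) \<in> ?J - {(i0, u)} \<longrightarrow> group_algebra_op smul (\<pi> i) a v = 0)"
  proof (rule density[OF assms(5) smooth irr])
    show "\<exists>c. \<forall>v\<in>V i. f v = smul c v"
      if "i \<in> {1..n}" "linear_betw smul (V i) (V i) f"
        "\<And>g v. v \<in> V i \<Longrightarrow> f (\<pi> i g v) = \<pi> i g (f v)" for i f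
      using schur_admissible[OF smooth adm irr] that by blast
    show "independent {v. (i, v) \<in> ?J}" for i
      using C(2) independent_empty by (cases "i \<in> {1..n}") auto
    show "i \<in> {1..n} \<and> v \<in> V i" if "(i, v) \<in> ?J" for i v
      using that C(3) smooth_rep.fixed_vectors_def[OF smooth] by fastforce
    show "\<not> rep_isomorphic smul (V i) (\<pi> i) (V j) (\<pi> j)"
      if "i \<in> {1..n}" "j \<in> {1..n}" "i \<noteq> j" for i j
      using assms(9) that .
  qed (use C i0 w in auto)
  then obtain a where a: "group_algebra_op smul (\<pi> i0) a u = w"
    and kill: "\<And>i v. i \<in> {1..n} \<Longrightarrow> v \<in> C i \<Longrightarrow> (i, v) \<noteq> (i0, u) \<Longrightarrow> group_algebra_op smul (\<pi> i) a v = 0"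
    by blast

  let ?\<phi> = "test_function (S0.coord \<delta>\<^sub>1) K a"
  have zero: "Theta smul (V i) ?\<nu> (T i) ?\<phi> = 0" if i: "i \<in> {1..n}" "i \<noteq> i0" for i
  proof -
    interpret S: invariant_subgroup_rep act IntX \<omega> smul "V i" "\<pi> i" "T i" \<mu> \<delta>\<^sub>0 \<delta>\<^sub>1 K
      by (rule setting[OF i(1)])
    show ?thesis
    proof (rule S.Theta_test_function_zero)
      fix y assume "y \<in> S.fixed_vectors K"
      then have "y \<in> span (C i)" using C(4)[OF i(1)] by blast
      have "S.op a y \<in> {0}"
      proof (rule S.op_span[OF _ subspace_single_0 _ \<open>y \<in> span (C i)\<close>])
        show "C i \<subseteq> V i" using C(3)[OF i(1)] by (auto simp: S.fixed_vectors_def)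
        show "S.op a v \<in> {0}" if "v \<in> C i" for v using kill[OF i(1) that] i(2) by simp
      qed
      then show "S.op a y = 0" by simp
    qed
  qed
  have "Theta smul (V i0) ?\<nu> (T i0) ?\<phi> = S0.vol"
  proof (rule S0.Theta_test_function_line[OF wK w(2)])
    show "R0.op a (T i0 \<delta>\<^sub>1 w) = w" using a by (simp add: u_def)
    fix y assume "y \<in> R0.fixed_vectors K"
    then have "y \<in> span (C i0)" using C(4)[OF i0] by blast
    show "R0.op a y \<in> span {w}"
    proof (rule R0.op_span[OF _ subspace_span _ \<open>y \<in> span (C i0)\<close>])
      show "C i0 \<subseteq> V i0" using C(3)[OF i0] by (auto simp: R0.fixed_vectors_def)
      show "R0.op a v \<in> span {w}" if "v \<in> C i0" for v
        using kill[OF i0 that] a by (cases "v = u") (auto intro: span_base span_zero)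
    qed
  qed
  moreover have "(\<Sum>i\<in>{1..n}. c i * Theta smul (V i) ?\<nu> (T i) ?\<phi>) =
      (\<Sum>i\<in>{1..n}. if i = i0 then c i0 * Theta smul (V i0) ?\<nu> (T i0) ?\<phi> else 0)"
    using zero by (intro sum.cong) auto
  moreover have "\<dots> = c i0 * Theta smul (V i0) ?\<nu> (T i0) ?\<phi>" using i0 by simp
  ultimately have "c i0 * S0.vol = 0"
    using vanish S0.test_function_Cc_infty[of a] by simp
  then show "c i0 = 0" using S0.vol_nonzero by simp
qed

end
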